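(* Let $(X_j,Y_j)_{j\ge 1}$ be i.i.d. real random pairs with continuous marginal distribution functions and copula $C$, where $C$ has continuous partial derivatives. Let $m\ge 1$ and, for $k\in\{1,\dots,m\}$, let $\alpha_k\in(0,1)$ and $i_k(n)=\alpha_k n$. Write $\alpha=(\alpha_1,\dots,\alpha_m)$. Then the mean squared error of the average nonparametric estimator $$\widehat{\Lambda}_{L,n}\left(\frac{i_1(n)}{n},\dots,\frac{i_m(n)}{n}\right)=\frac1m\sum_{k=1}^m\widehat\lambda_{L,n}\left(\frac{i_k(n)}{n}\right)$$ of the lower tail dependence coefficient $\lambda_L$ behaves asymptotically in the following manner: $$\mathbb{E}\left[\left(\widehat \Lambda_{L,n}\left(\frac{i_1(n)}{n},\dots,\frac{i_m(n)}{n}\right)-\lambda_L\right)^2\right] = V^{\Lambda}_{L,n}(\alpha) + \left(\frac{1}{m}\sum_{k=1}^{m}\frac{1}{\alpha_k}\delta(\alpha_k)-\delta'(0)\right)^2,$$ where $$\lim_{n\to\infty} n\,V^{\Lambda}_{L,n}(\alpha)= \frac{1}{m^2}\sum_{k,l=1}^{m}\frac{1}{\alpha_k\alpha_l}\mathcal K(\alpha_k,\alpha_l)$$ and $$\begin{aligned} \mathcal K(u,v) = {}& \delta(u\wedge v)-\delta(u)\delta(v) + \big(h_1(u)h_1(v)+h_2(u)h_2(v)\big)\big((u\wedge v)-uv\big) \\ & - h_1(v)\big(C(u\wedge v,u)-v\delta(u)\big) - h_2(v)\big(C(u,u\wedge v)-v\delta(u)\big) \\ & - h_1(u)\big(C(u\wedge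 v,v)-u\delta(v)\big) - h_2(u)\big(C(v,u\wedge v)-u\delta(v)\big) \\ & + h_1(u)h_2(v)\big(C(u,v)-uv\big)+ h_1(v)h_2(u)\big(C(v,u)-uv\big), \end{aligned}$$ with $a\wedge b$ denoting the minimum of $a$ and $b$.
   Context: The copula $C$ of a pair $(X,Y)$ with continuous marginal distribution functions $F_X,F_Y$ and joint distribution function $F$ is the function on $[0,1]^2$ with $F(x,y)=C(F_X(x),F_Y(y))$. The lower tail dependence coefficient is $\lambda_L=\lim_{u\to0^+}C(u,u)/u$ (assumed to exist). The diagonal section of $C$ is $\delta(u)=C(u,u)$; $\delta'(0)$ is its (right) derivative at $0$, so that $\lambda_L=\delta'(0)$. The h-functions are $h_1(u,v)=\partial C(u,v)/\partial u$ and $h_2(u,v)=\partial C(u,v)/\partial v$, and one writes $h_1(u)=h_1(u,u)$, $h_2(u)=h_2(u,u)$. Given $n$ observations $(X_j,Y_j)$, $1\le j\le n$, the empirical marginal distribution functions are $\widehat F_{X,n}(x)=\frac1n\sum_{j=1}^n \mathbf 1\{X_j\le x\}$ and $\widehat F_{Y,n}(y)=\frac1n\sum_{j=1}^n \mathbf 1\{Y_j\le y\}$, and the empirical copula is $$\widehat C_n(u,v)=\frac1n\sum_{j=1}^n \mathbf 1\{\widehat F_{X,n}(X_j)\le u\}\,\mathbf 1\{\widehat F_{Y,n}(Y_j)\le v\}.$$ The nonparametric estimator of the lower tail dependence coefficient with threshold $i$ is $$\widehat\lambda_{L,n}\left(\frac in\right)=\frac{\widehat C_n\left(\frac in,\frac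 in\right)}{\frac in}.$$ With $i=i_k(n)=\alpha_k n$ this formula is evaluated at $i_k(n)/n=\alpha_k$.
   Formalization: The exact identity fails (e.g. C(u,v)=uv, m=1: n(MSE − squared bias) oscillates). Here V is the estimator's variance and the squared term is the displayed bias plus a remainder r_n with √n·r_n → 0; the partial derivatives need be continuous only on the open unit square. *)

theory Defs
  imports "HOL-Probability.Probability"
begin

text \<open>Copulas are curried functions on the reals; only their values on the unit square matter.\<close>

definition is_copula :: "(real \<Rightarrow> real \<Rightarrow> real) \<Rightarrow> bool" where
  "is_copula C \<longleftrightarrow>
     (\<forall>u\<in>{0..1}. C u 0 = 0 \<and> C 0 u = 0 \<and> C u 1 = u \<and> C 1 u = u) \<and>
     (\<forall>u1 u2 v1 v2. 0 \<le> u1 \<and> u1 \<le> u2 \<and> u2 \<le> 1 \<and> 0 \<le> v1 \<and> v1 \<le> v2 \<and> v2 \<le> 1 \<longrightarrow>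
        0 \<le> C u2 v2 - C u1 v2 - C u2 v1 + C u1 v1)"

definition copula_of ::
  "'a measure \<Rightarrow> ('a \<Rightarrow> real) \<Rightarrow> ('a \<Rightarrow> real) \<Rightarrow> (real \<Rightarrow> real \<Rightarrow> real) \<Rightarrow> bool" where
  "copula_of M X Y C \<longleftrightarrow> is_copula C \<and>
     (\<forall>x y. measure M {\<omega> \<in> space M. X \<omega> \<le> x \<and> Y \<omega> \<le> y}
             = C (cdf (distr M borel X) x) (cdf (distr M borel Y) y))"

definition h1 :: "(real \<Rightarrow> real \<Rightarrow> real) \<Rightarrow> real \<Rightarrow> real \<Rightarrow> real" where
  "h1 C u v = deriv (\<lambda>s. C s v) u"

definition h2 :: "(real \<Rightarrow> real \<Rightarrow> real) \<Rightarrow> real \<Rightarrow> real \<Rightarrow> real" where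
  "h2 C u v = deriv (\<lambda>t. C u t) v"

text \<open>Partial derivatives are required on the open unit square. On the closed square, continuity
  of the h-functions at the origin would force the lower tail dependence coefficient to be zero.\<close>

definition continuous_partials :: "(real \<Rightarrow> real \<Rightarrow> real) \<Rightarrow> bool" where
  "continuous_partials C \<longleftrightarrow>
     (\<forall>u\<in>{0<..<1}. \<forall>v\<in>{0<..<1}.
        (\<lambda>s. C s v) differentiable (at u) \<and> (\<lambda>t. C u t) differentiable (at v)) \<and>
     continuous_on ({0<..<1} \<times> {0<..<1}) (\<lambda>(u, v). h1 C u v) \<and>
     continuous_on ({0<..<1} \<times> {0<..<1}) (\<lambda>(u, v). h2 C u v)"

definition diagonal :: "(real \<Rightarrow> real \<Rightarrow> real) \<Rightarrow> real \<Rightarrow> real" where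
  "diagonal C u = C u u"

definition diagonal_deriv0 :: "(real \<Rightarrow> real \<Rightarrow> real) \<Rightarrow> real" where
  "diagonal_deriv0 C = vector_derivative (diagonal C) (at_right 0)"

text \<open>Only meaningful when the limit exists, which has to be assumed separately.\<close>

definition lower_tail_dependence :: "(real \<Rightarrow> real \<Rightarrow> real) \<Rightarrow> real" where
  "lower_tail_dependence C = Lim (at_right 0) (\<lambda>u. C u u / u)"

text \<open>Observations are numbered from 1, so that a sample of size \<open>n\<close> consists of the
  values of the sequence at \<open>1, \<dots>, n\<close>.\<close>

definition emp_cdf :: "(nat \<Rightarrow> real) \<Rightarrow> nat \<Rightarrow> real \<Rightarrow> real" where
  "emp_cdf x n t = (\<Sum>j=1..n. of_bool (x j \<le> t)) / real n"

definition emp_copula ::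
  "(nat \<Rightarrow> real) \<Rightarrow> (nat \<Rightarrow> real) \<Rightarrow> nat \<Rightarrow> real \<Rightarrow> real \<Rightarrow> real" where
  "emp_copula x y n u v =
     (\<Sum>j=1..n. of_bool (emp_cdf x n (x j) \<le> u) * of_bool (emp_cdf y n (y j) \<le> v)) / real n"

text \<open>The thresholds \<open>i\<close> are real numbers, not necessarily integers.\<close>

definition tail_estimator :: "(nat \<Rightarrow> real) \<Rightarrow> (nat \<Rightarrow> real) \<Rightarrow> nat \<Rightarrow> real \<Rightarrow> real" where
  "tail_estimator x y n i = emp_copula x y n (i / real n) (i / real n) / (i / real n)"

definition avg_tail_estimator ::
  "(nat \<Rightarrow> real) \<Rightarrow> (nat \<Rightarrow> real) \<Rightarrow> nat \<Rightarrow> nat \<Rightarrow> (nat \<Rightarrow> real) \<Rightarrow> real" where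
  "avg_tail_estimator x y m n i = (\<Sum>k=1..m. tail_estimator x y n (i k)) / real m"

definition K_kernel :: "(real \<Rightarrow> real \<Rightarrow> real) \<Rightarrow> real \<Rightarrow> real \<Rightarrow> real" where
  "K_kernel C u v =
     diagonal C (min u v) - diagonal C u * diagonal C v
     + (h1 C u u * h1 C v v + h2 C u u * h2 C v v) * (min u v - u * v)
     - h1 C v v * (C (min u v) u - v * diagonal C u)
     - h2 C v v * (C u (min u v) - v * diagonal C u)
     - h1 C u u * (C (min u v) v - u * diagonal C v)
     - h2 C u u * (C v (min u v) - u * diagonal C v)
     + h1 C u u * h2 C v v * (C u v - u * v)
     + h1 C v v * h2 C u u * (C v u - u * v)"

definition mean_squared_error :: "'a measure \<Rightarrow> ('a \<Rightarrow> real) \<Rightarrow> real \<Rightarrow> real" where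
  "mean_squared_error M T c = (\<integral>\<omega>. (T \<omega> - c)\<^sup>2 \<partial>M)"

definition estimator_variance :: "'a measure \<Rightarrow> ('a \<Rightarrow> real) \<Rightarrow> real" where
  "estimator_variance M T = (\<integral>\<omega>. (T \<omega> - (\<integral>\<eta>. T \<eta> \<partial>M))\<^sup>2 \<partial>M)"

end

theory Submission
  imports Defs
begin

text \<open>
  Write \<open>F\<close>, \<open>G\<close> for the marginal distribution functions and \<open>q\<^sub>X(u)\<close>, \<open>q\<^sub>Y(u)\<close> for their quantiles.
  Up to an error that tends to \<open>0\<close> in \<open>L\<^sup>2\<close>, the rescaled error of the empirical copula at \<open>(u, u)\<close> is a
  normalised sum of the i.i.d. variables
  \<open>1{X \<le> q\<^sub>X(u), Y \<le> q\<^sub>Y(u)} - h\<^sub>1(u) 1{X \<le> q\<^sub>X(u)} - h\<^sub>2(u) 1{Y \<le> q\<^sub>Y(u)}\<close>,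
  whose covariances are \<open>K(u, v)\<close>; both the bias and the variance statement follow.

  The error tends to \<open>0\<close> in probability: the set of \<open>j\<close> with rank of \<open>X\<^sub>j\<close> at most \<open>n u\<close> is squeezed
  between two sets \<open>{X\<^sub>j \<le> q\<^sub>X(s)}\<close> with \<open>s\<close> on a finite grid of mesh \<open>\<delta> / sqrt n\<close> around \<open>u\<close>, on which
  Chebyshev's inequality controls the oscillation of the empirical process, and \<open>C\<close> is totally
  differentiable at \<open>(u, u)\<close>. It is uniformly square integrable: if there are no ties, that set
  differs from \<open>{X\<^sub>j \<le> q\<^sub>X(u)}\<close> in at most \<open>|#{X\<^sub>j \<le> q\<^sub>X(u)} - n u| + 1\<close> indices, whose fourth moment is
  \<open>O(n\<^sup>2)\<close>.
\<close>

section \<open>Centred sums of independent, identically distributed variables\<close>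

text \<open>The value type is left general so that a pair \<open>(X j, Y j)\<close> counts as one
  observation; joint and marginal indicators are then all functions of it and share one theory of
  sums.\<close>

locale iid_sequence = prob_space M
  for M :: "'a measure" and Z :: "nat \<Rightarrow> 'a \<Rightarrow> 'b :: topological_space" +
  assumes indep: "indep_vars (\<lambda>_. borel) Z {1..}"
    and ident: "\<And>j. j \<ge> 1 \<Longrightarrow> distr M borel (Z j) = distr M borel (Z 1)"
begin

definition mean :: "('b \<Rightarrow> real) \<Rightarrow> real" where
  "mean f = expectation (\<lambda>\<omega>. f (Z 1 \<omega>))"

definition cov :: "('b \<Rightarrow> real) \<Rightarrow> ('b \<Rightarrow> real) \<Rightarrow> real" where
  "cov f g = mean (\<lambda>z. f z * g z) - mean f * mean g"

definition csum :: "nat \<Rightarrow> ('b \<Rightarrow> real) \<Rightarrow> 'a \<Rightarrow> real" where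
  "csum n f \<omega> = (\<Sum>j=1..n. f (Z j \<omega>) - mean f)"

text \<open>Bounded measurable functions are closed under sums, differences and products, so this
  one predicate discharges the integrability conditions on functions of the observations.\<close>

definition bdd_borel :: "('b \<Rightarrow> real) \<Rightarrow> bool" where
  "bdd_borel f \<longleftrightarrow> f \<in> borel_measurable borel \<and> (\<exists>B. \<forall>z. \<bar>f z\<bar> \<le> B)"

lemma Z_measurable [measurable]: "j \<ge> 1 \<Longrightarrow> Z j \<in> borel_measurable M"
  using indep by (auto simp: indep_vars_def)

lemma bdd_borelI: "f \<in> borel_measurable borel \<Longrightarrow> (\<And>z. \<bar>f z\<bar> \<le> B) \<Longrightarrow> bdd_borel f"
  unfolding bdd_borel_def by blast

lemma bdd_borel_measurable: "bdd_borel f \<Longrightarrow> f \<in> borel_measurable borel"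
  by (simp add: bdd_borel_def)

lemma bdd_borelE:
  assumes "bdd_borel f"
  obtains B where "B \<ge> 0" "\<And>z. \<bar>f z\<bar> \<le> B"
proof -
  obtain B where "\<And>z. \<bar>f z\<bar> \<le> B"
    using assms by (auto simp: bdd_borel_def)
  \<comment> \<open>Any point at all will do: a bound on an absolute value at one point is
    nonnegative.\<close>
  moreover have "B \<ge> 0"
    using calculation[of undefined] by linarith
  ultimately show ?thesis
    using that by blast
qed

lemma bdd_borel_const: "bdd_borel (\<lambda>_. c)"
  by (rule bdd_borelI[where B="\<bar>c\<bar>"]) auto

lemma bdd_borel_add:
  assumes "bdd_borel f" "bdd_borel g"
  shows "bdd_borel (\<lambda>z. f z + g z)"
proof -
  obtain A B where "\<And>z. \<bar>f z\<bar> \<le> A" "\<And>z. \<bar>g z\<bar> \<le> B"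
    using assms bdd_borelE by metis
  then have "\<bar>f z + g z\<bar> \<le> A + B" for z
    by (intro order.trans[OF abs_triangle_ineq] add_mono)
  then show ?thesis
    using assms by (intro bdd_borelI[where B="A + B"]) (auto simp: bdd_borel_def)
qed

lemma bdd_borel_mult:
  assumes "bdd_borel f" "bdd_borel g"
  shows "bdd_borel (\<lambda>z. f z * g z)"
proof -
  obtain A where A: "A \<ge> 0" "\<And>z. \<bar>f z\<bar> \<le> A"
    using assms(1) bdd_borelE by metis
  obtain B where B: "B \<ge> 0" "\<And>z. \<bar>g z\<bar> \<le> B"
    using assms(2) bdd_borelE by metis
  have "\<bar>f z * g z\<bar> \<le> A * B" for z
    unfolding abs_mult using A B by (intro mult_mono) auto
  then show ?thesis
    using assms by (intro bdd_borelI[where B="A * B"]) (auto simp: bdd_borel_def)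
qed

lemma bdd_borel_cmult: "bdd_borel f \<Longrightarrow> bdd_borel (\<lambda>z. c * f z)"
  by (intro bdd_borel_mult bdd_borel_const)

lemma bdd_borel_diff:
  assumes "bdd_borel f" "bdd_borel g"
  shows "bdd_borel (\<lambda>z. f z - g z)"
  using bdd_borel_add[OF assms(1) bdd_borel_cmult[OF assms(2), of "-1"]] by simp

lemma bdd_borel_sum: "(\<And>k. k \<in> A \<Longrightarrow> bdd_borel (f k)) \<Longrightarrow> bdd_borel (\<lambda>z. \<Sum>k\<in>A. f k z)"
  by (induction A rule: infinite_finite_induct) (auto intro: bdd_borel_add bdd_borel_const)

lemmas bdd_borel_intros =
  bdd_borel_const bdd_borel_add bdd_borel_mult bdd_borel_diff bdd_borel_sum

lemma integrable_bdd:
  "h \<in> borel_measurable M \<Longrightarrow> (\<And>\<omega>. \<bar>h \<omega>\<bar> \<le> B) \<Longrightarrow> integrable M (h :: 'a \<Rightarrow> real)"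
  by (rule integrable_const_bound[where B=B]) auto

lemma comp_measurable: "bdd_borel f \<Longrightarrow> j \<ge> 1 \<Longrightarrow> (\<lambda>\<omega>. f (Z j \<omega>)) \<in> borel_measurable M"
  using measurable_compose[OF Z_measurable bdd_borel_measurable] by blast

lemma comp_integrable:
  assumes "bdd_borel f" "j \<ge> 1"
  shows "integrable M (\<lambda>\<omega>. f (Z j \<omega>))"
proof -
  obtain B where "\<And>z. \<bar>f z\<bar> \<le> B"
    using assms(1) bdd_borelE by metis
  then show ?thesis
    using assms by (intro integrable_bdd[where B=B] comp_measurable)
qed

lemma expectation_comp:
  assumes "bdd_borel f" "j \<ge> 1"
  shows "expectation (\<lambda>\<omega>. f (Z j \<omega>)) = mean f"
proof -
  have "expectation (\<lambda>\<omega>. f (Z j \<omega>)) = integral\<^sup>L (distr M borel (Z j)) f"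
    using assms by (subst integral_distr) (auto intro: bdd_borel_measurable)
  also have "\<dots> = integral\<^sup>L (distr M borel (Z 1)) f"
    using ident[OF assms(2)] by simp
  also have "\<dots> = mean f"
    using assms by (subst integral_distr) (auto intro: bdd_borel_measurable simp: mean_def)
  finally show ?thesis .
qed

lemma mean_const: "mean (\<lambda>_. c) = c"
  by (simp add: mean_def prob_space)

lemma mean_add: "bdd_borel f \<Longrightarrow> bdd_borel g \<Longrightarrow> mean (\<lambda>z. f z + g z) = mean f + mean g"
  unfolding mean_def by (intro Bochner_Integration.integral_add comp_integrable) auto

lemma mean_diff: "bdd_borel f \<Longrightarrow> bdd_borel g \<Longrightarrow> mean (\<lambda>z. f z - g z) = mean f - mean g"
  unfolding mean_def by (intro Bochner_Integration.integral_diff comp_integrable) auto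

lemma mean_cmult: "mean (\<lambda>z. c * f z) = c * mean f"
  by (simp add: mean_def)

lemma mean_sum:
  "(\<And>k. k \<in> A \<Longrightarrow> bdd_borel (f k)) \<Longrightarrow> mean (\<lambda>z. \<Sum>k\<in>A. f k z) = (\<Sum>k\<in>A. mean (f k))"
  unfolding mean_def by (intro Bochner_Integration.integral_sum comp_integrable) auto

lemma mean_mono:
  "bdd_borel f \<Longrightarrow> bdd_borel g \<Longrightarrow> (\<And>z. f z \<le> g z) \<Longrightarrow> mean f \<le> mean g"
  unfolding mean_def by (intro integral_mono comp_integrable) auto

lemma mean_unit_interval:
  assumes "bdd_borel f" "\<And>z. f z \<in> {0..1}"
  shows "mean f \<in> {0..1}"
  using mean_mono[OF assms(1) bdd_borel_const[of 1]] mean_mono[OF bdd_borel_const[of 0] assms(1)]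
    assms(2) by (auto simp: mean_const)

section \<open>Bilinearity of the covariance\<close>

lemma cov_commute: "cov f g = cov g f"
  by (simp add: cov_def mult.commute)

lemma cov_cmult_left: "cov (\<lambda>z. c * f z) g = c * cov f g"
  using mean_cmult[of c "\<lambda>z. f z * g z"] by (simp add: cov_def mean_cmult algebra_simps)

lemma cov_diff_left:
  assumes "bdd_borel f" "bdd_borel g" "bdd_borel h"
  shows "cov (\<lambda>z. f z - g z) h = cov f h - cov g h"
  using mean_diff[of "\<lambda>z. f z * h z" "\<lambda>z. g z * h z"] assms
  by (simp add: cov_def mean_diff bdd_borel_mult algebra_simps)

lemma cov_sum_left:
  assumes "\<And>k. k \<in> A \<Longrightarrow> bdd_borel (f k)" "bdd_borel h"
  shows "cov (\<lambda>z. \<Sum>k\<in>A. f k z) h = (\<Sum>k\<in>A. cov (f k) h)"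
  using mean_sum[of A "\<lambda>k z. f k z * h z"] assms
  by (simp add: cov_def mean_sum bdd_borel_mult sum_distrib_right sum_subtractf)

lemma cov_cmult_right: "cov g (\<lambda>z. c * f z) = c * cov g f"
  by (metis cov_cmult_left cov_commute)

lemma cov_diff_right:
  assumes "bdd_borel f" "bdd_borel g" "bdd_borel h"
  shows "cov h (\<lambda>z. f z - g z) = cov h f - cov h g"
  using cov_diff_left[OF assms] by (simp add: cov_commute)

lemma cov_sum_right:
  assumes "\<And>k. k \<in> A \<Longrightarrow> bdd_borel (f k)" "bdd_borel h"
  shows "cov h (\<lambda>z. \<Sum>k\<in>A. f k z) = (\<Sum>k\<in>A. cov h (f k))"
  using cov_sum_left[OF assms] by (simp add: cov_commute)

section \<open>Integrability and linearity of centred sums\<close>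

lemma csum_measurable: "bdd_borel f \<Longrightarrow> csum n f \<in> borel_measurable M"
  unfolding csum_def
  by (intro borel_measurable_sum borel_measurable_diff comp_measurable borel_measurable_const) auto

lemma csum_bounded:
  assumes "bdd_borel f"
  obtains B where "B \<ge> 0" "\<And>\<omega>. \<bar>csum n f \<omega>\<bar> \<le> B"
proof -
  obtain B where B: "B \<ge> 0" "\<And>z. \<bar>f z\<bar> \<le> B"
    using assms bdd_borelE by metis
  have "\<bar>csum n f \<omega>\<bar> \<le> (\<Sum>j=1..n. B + \<bar>mean f\<bar>)" for \<omega>
    unfolding csum_def
    by (intro order.trans[OF sum_abs] sum_mono order.trans[OF abs_triangle_ineq4] add_mono B) auto
  then show ?thesis
    using B(1) by (intro that[of "\<Sum>j=1..n. B + \<bar>mean f\<bar>"]) (auto intro!: sum_nonneg)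
qed

lemma csum_power_integrable:
  assumes "bdd_borel f"
  shows "integrable M (\<lambda>\<omega>. csum n f \<omega> ^ p)"
proof -
  obtain B where "\<And>\<omega>. \<bar>csum n f \<omega>\<bar> \<le> B"
    using assms csum_bounded by metis
  then have "\<bar>csum n f \<omega> ^ p\<bar> \<le> B ^ p" for \<omega>
    unfolding power_abs by (intro power_mono) auto
  then show ?thesis
    using csum_measurable[OF assms] by (intro integrable_bdd[where B="B ^ p"]) auto
qed

lemma csum_cmult: "csum n (\<lambda>z. c * f z) \<omega> = c * csum n f \<omega>"
  by (simp add: csum_def mean_cmult sum_distrib_left right_diff_distrib)

lemma csum_diff:
  "bdd_borel f \<Longrightarrow> bdd_borel g \<Longrightarrow> csum n (\<lambda>z. f z - g z) \<omega> = csum n f \<omega> - csum n g \<omega>"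
  by (simp add: csum_def mean_diff flip: sum_subtractf) (simp add: algebra_simps)

lemma csum_sum:
  assumes "\<And>k. k \<in> A \<Longrightarrow> bdd_borel (f k)"
  shows "csum n (\<lambda>z. \<Sum>k\<in>A. f k z) \<omega> = (\<Sum>k\<in>A. csum n (f k) \<omega>)"
  using assms by (simp add: csum_def mean_sum sum_subtractf[symmetric])
    (subst sum.swap, simp add: sum_subtractf)

lemma expectation_csum: "bdd_borel f \<Longrightarrow> expectation (csum n f) = 0"
  unfolding csum_def
  by (subst Bochner_Integration.integral_sum)
    (simp_all add: comp_integrable expectation_comp prob_space)

text \<open>Independence is restricted to the disjoint index sets \<open>{i}\<close> and
  \<open>{j}\<close> and then transported along evaluation at the single index.\<close>

lemma indep_var_Z:
  assumes "i \<ge> 1" "j \<ge> 1" "i \<noteq> j"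
  shows "indep_var borel (Z i) borel (Z j)"
proof -
  have "indep_var (PiM {i} (\<lambda>_. borel)) (\<lambda>\<omega>. restrict (\<lambda>i. Z i \<omega>) {i})
      (PiM {j} (\<lambda>_. borel)) (\<lambda>\<omega>. restrict (\<lambda>i. Z i \<omega>) {j})"
    using assms by (intro indep_var_restrict[OF indep]) auto
  then have "indep_var borel ((\<lambda>h. h i) \<circ> (\<lambda>\<omega>. restrict (\<lambda>i. Z i \<omega>) {i}))
      borel ((\<lambda>h. h j) \<circ> (\<lambda>\<omega>. restrict (\<lambda>i. Z i \<omega>) {j}))"
    by (rule indep_var_compose) (auto intro: measurable_component_singleton)
  then show ?thesis
    by (simp add: comp_def)
qed

text \<open>After centring, independence kills the off-diagonal terms of the double sum, and each of
  the \<open>n\<close> diagonal terms equals the covariance.\<close>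

lemma expectation_csum_csum:
  assumes f: "bdd_borel f" and g: "bdd_borel g"
  shows "expectation (\<lambda>\<omega>. csum n f \<omega> * csum n g \<omega>) = real n * cov f g"
proof -
  define f' where "f' = (\<lambda>z. f z - mean f)"
  define g' where "g' = (\<lambda>z. g z - mean g)"
  have f': "bdd_borel f'" and g': "bdd_borel g'"
    unfolding f'_def g'_def using f g by (auto intro: bdd_borel_intros)
  have [simp]: "mean f' = 0" "mean g' = 0"
    unfolding f'_def g'_def using f g
    by (simp_all add: mean_diff bdd_borel_const mean_const)
  have "mean (\<lambda>z. f' z * g' z) = cov f' g'"
    by (simp add: cov_def)
  also have "\<dots> = cov f g"
    unfolding f'_def g'_def using f g
    by (simp add: cov_diff_left cov_diff_right bdd_borel_intros)
       (simp add: cov_def mean_cmult mean_const mult.commute[of _ "mean g"])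
  finally have diag: "mean (\<lambda>z. f' z * g' z) = cov f g" .
  have int: "integrable M (\<lambda>\<omega>. f' (Z i \<omega>) * g' (Z j \<omega>))" if "i \<ge> 1" "j \<ge> 1" for i j
  proof -
    obtain A where A: "A \<ge> 0" "\<And>z. \<bar>f' z\<bar> \<le> A"
      using f' bdd_borelE by metis
    obtain B where B: "B \<ge> 0" "\<And>z. \<bar>g' z\<bar> \<le> B"
      using g' bdd_borelE by metis
    show ?thesis
      using A B comp_measurable[OF f' that(1)] comp_measurable[OF g' that(2)]
      by (intro integrable_bdd[where B="A * B"]) (auto simp: abs_mult intro!: mult_mono)
  qed
  have E: "expectation (\<lambda>\<omega>. f' (Z i \<omega>) * g' (Z j \<omega>)) = (if i = j then cov f g else 0)"
    if "i \<ge> 1" "j \<ge> 1" for i j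
  proof (cases "i = j")
    case True
    then show ?thesis
      using expectation_comp[OF bdd_borel_mult[OF f' g'] that(1)] diag by simp
  next
    case False
    have "indep_var borel (f' \<circ> Z i) borel (g' \<circ> Z j)"
      by (rule indep_var_compose[OF indep_var_Z[OF that False]])
         (use f' g' bdd_borel_measurable in auto)
    then have "expectation (\<lambda>\<omega>. f' (Z i \<omega>) * g' (Z j \<omega>))
        = expectation (\<lambda>\<omega>. f' (Z i \<omega>)) * expectation (\<lambda>\<omega>. g' (Z j \<omega>))"
      using that f' g' by (intro indep_var_lebesgue_integral comp_integrable) (auto simp: comp_def)
    then show ?thesis
      using False expectation_comp[OF f' that(1)] by simp
  qed
  have "expectation (\<lambda>\<omega>. csum n f \<omega> * csum n g \<omega>)
      = expectation (\<lambda>\<omega>. \<Sum>i=1..n. \<Sum>j=1..n. f' (Z i \<omega>) * g' (Z j \<omega>))"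
    by (simp add: csum_def f'_def g'_def sum_product)
  also have "\<dots> = (\<Sum>i=1..n. \<Sum>j=1..n. expectation (\<lambda>\<omega>. f' (Z i \<omega>) * g' (Z j \<omega>)))"
    by (subst Bochner_Integration.integral_sum)
       (auto intro!: sum.cong Bochner_Integration.integral_sum Bochner_Integration.integrable_sum int)
  also have "\<dots> = (\<Sum>i=1..n. \<Sum>j=1..n. if i = j then cov f g else 0)"
    by (intro sum.cong E) auto
  also have "\<dots> = real n * cov f g"
    by simp
  finally show ?thesis .
qed

lemma cov_self_le: "cov f f \<le> mean (\<lambda>z. (f z)\<^sup>2)"
  by (simp add: cov_def power2_eq_square)

text \<open>Chebyshev's inequality at the scale \<open>sqrt n\<close>, where the linear growth of
  the variance cancels and the bound is free of \<open>n\<close>.\<close>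

lemma prob_csum_le:
  assumes f: "bdd_borel f" and "c > 0" "n \<ge> 1"
  shows "prob {\<omega> \<in> space M. \<bar>csum n f \<omega>\<bar> \<ge> c * sqrt n} \<le> cov f f / c\<^sup>2"
proof -
  have "prob {\<omega> \<in> space M. \<bar>csum n f \<omega> - expectation (csum n f)\<bar> \<ge> c * sqrt n}
      \<le> variance (csum n f) / (c * sqrt n)\<^sup>2"
    using assms by (intro Chebyshev_inequality csum_measurable csum_power_integrable) auto
  also have "variance (csum n f) = real n * cov f f"
    using expectation_csum_csum[OF f f, of n] by (simp add: expectation_csum f power2_eq_square)
  also have "real n * cov f f / (c * sqrt n)\<^sup>2 = cov f f / c\<^sup>2"
    using assms by (simp add: power_mult_distrib)
  finally show ?thesis
    by (simp add: expectation_csum f)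
qed

text \<open>The new summand sees only observation \<open>Suc n\<close>, the old sum only those up to
  \<open>n\<close>. This factorises the mixed moments in the induction for the fourth
  moment.\<close>

lemma indep_csum_next:
  assumes "bdd_borel f"
  shows "indep_var borel (\<lambda>\<omega>. f (Z (Suc n) \<omega>) - mean f) borel (csum n f)"
proof -
  have "indep_vars (\<lambda>_. borel) Z (insert (Suc n) {1..n})"
    by (rule indep_vars_subset[OF indep]) auto
  then have "indep_vars (\<lambda>_. borel) (\<lambda>j \<omega>. f (Z j \<omega>) - mean f) (insert (Suc n) {1..n})"
    using bdd_borel_measurable[OF bdd_borel_diff[OF assms bdd_borel_const]]
    by (intro indep_vars_compose2[where Y="\<lambda>_ z. f z - mean f"])
  then show ?thesis
    unfolding csum_def by (intro indep_vars_sum) auto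
qed

text \<open>In the expansion of \<open>(S + T) ^ 4\<close>, with \<open>S\<close> the old sum and
  \<open>T\<close> the new summand, the terms linear in \<open>S\<close> or in \<open>T\<close>
  vanish by independence. Since \<open>\<bar>T\<bar> \<le> 1\<close> and
  \<open>E S\<^sup>2 \<le> n\<close>, the increment is at most \<open>6 n + 1\<close>, which is
  below \<open>3 (n + 1)\<^sup>2 - 3 n\<^sup>2\<close>.\<close>

lemma expectation_csum_power4:
  assumes f: "bdd_borel f" and unit: "\<And>z. f z \<in> {0..1}"
  shows "expectation (\<lambda>\<omega>. csum n f \<omega> ^ 4) \<le> 3 * (real n)\<^sup>2"
proof (induction n)
  case 0
  show ?case by (simp add: csum_def)
next
  case (Suc n)
  define S where "S = csum n f"
  define T where "T = (\<lambda>\<omega>. f (Z (Suc n) \<omega>) - mean f)"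
  have T1: "\<bar>T \<omega>\<bar> \<le> 1" for \<omega>
    using unit[of "Z (Suc n) \<omega>"] mean_unit_interval[OF f unit] by (auto simp: T_def)
  have [measurable]: "S \<in> borel_measurable M" "T \<in> borel_measurable M"
    using csum_measurable[OF f] comp_measurable[OF f, of "Suc n"] by (auto simp: S_def T_def)
  obtain B where B: "B \<ge> 0" "\<And>\<omega>. \<bar>S \<omega>\<bar> \<le> B"
    using csum_bounded[OF f, of n] by (metis S_def)
  have int: "integrable M (\<lambda>\<omega>. T \<omega> ^ p * S \<omega> ^ q)" for p q
    using power_mono[OF B(2), where n=q] power_mono[OF T1, where n=p]
    by (intro integrable_bdd[where B="1 * B ^ q"], measurable)
       (unfold abs_mult power_abs, intro mult_mono, auto)
  have int_S: "integrable M (\<lambda>\<omega>. S \<omega> ^ q)" and int_T: "integrable M (\<lambda>\<omega>. T \<omega> ^ q)" for q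
    using int[of 0 q] int[of q 0] by auto
  have E: "expectation (\<lambda>\<omega>. T \<omega> ^ p * S \<omega> ^ q)
      = expectation (\<lambda>\<omega>. T \<omega> ^ p) * expectation (\<lambda>\<omega>. S \<omega> ^ q)" for p q
  proof -
    have "indep_var borel ((\<lambda>x. x ^ p) \<circ> T) borel ((\<lambda>x. x ^ q) \<circ> S)"
      unfolding S_def T_def by (rule indep_var_compose[OF indep_csum_next[OF f]]) auto
    then show ?thesis
      by (intro indep_var_lebesgue_integral int_S int_T) (auto simp: comp_def)
  qed
  have ET: "expectation T = 0"
    using expectation_comp[OF f, of "Suc n"] comp_integrable[OF f, of "Suc n"]
    by (simp add: T_def prob_space)
  have ES: "expectation S = 0"
    unfolding S_def by (rule expectation_csum[OF f])
  have ET': "expectation (\<lambda>\<omega>. T \<omega> ^ p) \<le> 1" if "even p" for p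
  proof -
    have "T \<omega> ^ p \<le> 1" for \<omega>
      using power_mono[OF T1, where n=p, of \<omega>] that by (simp add: power_even_abs)
    then have "expectation (\<lambda>\<omega>. T \<omega> ^ p) \<le> expectation (\<lambda>_. 1)"
      by (intro integral_mono int_T) auto
    then show ?thesis by (simp add: prob_space)
  qed
  have ES2: "expectation (\<lambda>\<omega>. S \<omega> ^ 2) \<le> real n"
  proof -
    have "mean (\<lambda>z. (f z)\<^sup>2) \<le> 1"
      using mean_unit_interval[of "\<lambda>z. (f z)\<^sup>2"] f unit
      by (auto simp: power2_eq_square bdd_borel_mult mult_le_one)
    then have "cov f f \<le> 1"
      using cov_self_le[of f] by linarith
    then show ?thesis
      using expectation_csum_csum[OF f f, of n]
      by (simp add: S_def power2_eq_square mult_left_le)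
  qed
  have ES2_nonneg: "expectation (\<lambda>\<omega>. S \<omega> ^ 2) \<ge> 0"
    by simp
  have "csum (Suc n) f \<omega> ^ 4 = S \<omega> ^ 4 + 4 * (T \<omega> ^ 1 * S \<omega> ^ 3) + 6 * (T \<omega> ^ 2 * S \<omega> ^ 2)
      + 4 * (T \<omega> ^ 3 * S \<omega> ^ 1) + T \<omega> ^ 4" for \<omega>
  proof -
    have "csum (Suc n) f \<omega> = S \<omega> + T \<omega>"
      by (simp add: csum_def S_def T_def)
    then show ?thesis
      by (simp add: power4_eq_xxxx power3_eq_cube power2_eq_square algebra_simps)
  qed
  then have "expectation (\<lambda>\<omega>. csum (Suc n) f \<omega> ^ 4)
      = expectation (\<lambda>\<omega>. S \<omega> ^ 4 + 4 * (T \<omega> ^ 1 * S \<omega> ^ 3) + 6 * (T \<omega> ^ 2 * S \<omega> ^ 2)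
      + 4 * (T \<omega> ^ 3 * S \<omega> ^ 1) + T \<omega> ^ 4)"
    by simp
  also have "\<dots> = expectation (\<lambda>\<omega>. S \<omega> ^ 4) + 4 * expectation (\<lambda>\<omega>. T \<omega> ^ 1 * S \<omega> ^ 3)
      + 6 * expectation (\<lambda>\<omega>. T \<omega> ^ 2 * S \<omega> ^ 2)
      + 4 * expectation (\<lambda>\<omega>. T \<omega> ^ 3 * S \<omega> ^ 1) + expectation (\<lambda>\<omega>. T \<omega> ^ 4)"
    by (subst Bochner_Integration.integral_add Bochner_Integration.integral_mult_right_zero;
        (intro Bochner_Integration.integrable_add integrable_mult_right int int_S int_T)?)+ simp
  also have "\<dots> = expectation (\<lambda>\<omega>. S \<omega> ^ 4)
      + 6 * (expectation (\<lambda>\<omega>. T \<omega> ^ 2) * expectation (\<lambda>\<omega>. S \<omega> ^ 2)) + expectation (\<lambda>\<omega>. T \<omega> ^ 4)"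
    unfolding E by (simp add: ET ES)
  also have "\<dots> \<le> 3 * (real n)\<^sup>2 + 6 * (1 * real n) + 1"
    using ET'[of 2] ET'[of 4] ES2 ES2_nonneg Suc
    by (intro add_mono mult_left_mono mult_mono) (auto simp: S_def)
  also have "\<dots> \<le> 3 * (real (Suc n))\<^sup>2"
    by (simp add: power2_eq_square algebra_simps)
  finally show ?case .
qed

end

section \<open>Empirical distribution functions of a sample\<close>

lemma emp_cdf_eq_card: "emp_cdf x n t = real (card {j \<in> {1..n}. x j \<le> t}) / real n"
  by (simp add: emp_cdf_def sum_of_bool_eq flip: Collect_conj_eq) (simp add: Int_def)

lemma emp_cdf_mono: "s \<le> t \<Longrightarrow> emp_cdf x n s \<le> emp_cdf x n t"
  unfolding emp_cdf_def by (intro divide_right_mono sum_mono) (auto simp: of_bool_def)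

text \<open>The indices with \<open>emp_cdf x n (x j) \<le> u\<close> form a lower set in the order
  of the values, so comparing \<open>emp_cdf x n t\<close> with \<open>u\<close> decides whether
  this set contains \<open>{j. x j \<le> t}\<close> or is contained in it.\<close>

lemma emp_cdf_le_imp:
  "emp_cdf x n t \<le> u \<Longrightarrow> x j \<le> t \<Longrightarrow> emp_cdf x n (x j) \<le> u"
  using emp_cdf_mono order.trans by blast

lemma less_emp_cdf_imp:
  "u < emp_cdf x n t \<Longrightarrow> emp_cdf x n (x j) \<le> u \<Longrightarrow> x j \<le> t"
  by (rule ccontr) (use emp_cdf_mono[of t "x j" x n] in auto)

text \<open>Trades the data-dependent ranks for fixed thresholds, whose indicators are independent
  over \<open>j\<close> and so accessible to moment bounds. The mirror inequality that follows
  completes the sandwich.\<close>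

lemma emp_copula_ge:
  assumes "emp_cdf x n s \<le> u" "emp_cdf y n t \<le> v"
  shows "(\<Sum>j=1..n. of_bool (x j \<le> s) * of_bool (y j \<le> t)) / real n \<le> emp_copula x y n u v"
  unfolding emp_copula_def using assms
  by (intro divide_right_mono sum_mono mult_mono) (auto simp: of_bool_def emp_cdf_le_imp)

lemma emp_copula_le:
  assumes "u < emp_cdf x n s" "v < emp_cdf y n t"
  shows "emp_copula x y n u v \<le> (\<Sum>j=1..n. of_bool (x j \<le> s) * of_bool (y j \<le> t)) / real n"
  unfolding emp_copula_def using assms
  by (intro divide_right_mono sum_mono mult_mono)
     (auto simp: of_bool_def dest: less_emp_cdf_imp[OF assms(1)] less_emp_cdf_imp[OF assms(2)])

text \<open>The largest observation in the set dominates all others, so the empirical distribution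
  function at that observation, which is at most \<open>u\<close>, counts at least the whole
  set.\<close>

lemma card_emp_cdf_le:
  assumes "n \<ge> 1" "u \<ge> 0"
  shows "real (card {j \<in> {1..n}. emp_cdf x n (x j) \<le> u}) \<le> real n * u"
proof (cases "{j \<in> {1..n}. emp_cdf x n (x j) \<le> u} = {}")
  case True
  then show ?thesis using assms by (simp only: True) simp
next
  case False
  define A where "A = {j \<in> {1..n}. emp_cdf x n (x j) \<le> u}"
  have "finite A" "A \<noteq> {}"
    using False by (auto simp: A_def)
  then obtain k where k: "k \<in> A" "\<And>j. j \<in> A \<Longrightarrow> x j \<le> x k"
    using obtains_MAX[of A x] Max_ge[of "x ` A"] by (metis finite_imageI imageI)
  have "card A \<le> card {j \<in> {1..n}. x j \<le> x k}"
    using k by (intro card_mono) (auto simp: A_def)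
  moreover have "real (card {j \<in> {1..n}. x j \<le> x k}) \<le> real n * u"
    using k(1) assms by (simp add: A_def emp_cdf_eq_card field_simps)
  ultimately show ?thesis
    by (simp add: A_def)
qed

text \<open>Consider the smallest observation outside the set: without ties, only its own index and
  indices of the set lie at or below it, while its empirical distribution function exceeds
  \<open>u\<close>.\<close>

lemma card_emp_cdf_ge:
  assumes "inj_on x {1..n}" "n \<ge> 1" "{j \<in> {1..n}. emp_cdf x n (x j) \<le> u} \<noteq> {1..n}"
  shows "real n * u < real (card {j \<in> {1..n}. emp_cdf x n (x j) \<le> u}) + 1"
proof -
  define A where "A = {j \<in> {1..n}. emp_cdf x n (x j) \<le> u}"
  define B where "B = {1..n} - A"
  have "finite B" "B \<noteq> {}"
    using assms by (auto simp: B_def A_def)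
  then obtain k where k: "k \<in> B" "\<And>j. j \<in> B \<Longrightarrow> x k \<le> x j"
    using obtains_MIN[of B x] Min_le[of "x ` B"] by (metis finite_imageI imageI)
  have "{j \<in> {1..n}. x j \<le> x k} \<subseteq> insert k A"
  proof
    fix j assume j: "j \<in> {j \<in> {1..n}. x j \<le> x k}"
    show "j \<in> insert k A"
    proof (cases "j \<in> B")
      case True
      then have "x j = x k"
        using j k(2)[OF True] by (metis (mono_tags, lifting) antisym mem_Collect_eq)
      then show ?thesis
        using inj_onD[OF assms(1), of j k] k(1) j by (simp add: B_def)
    qed (use j in \<open>auto simp: B_def\<close>)
  qed
  then have "card {j \<in> {1..n}. x j \<le> x k} \<le> card (insert k A)"
    by (intro card_mono) (auto simp: A_def)
  also have "\<dots> \<le> card A + 1"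
    by (simp add: card_insert_if A_def)
  finally have "real (card {j \<in> {1..n}. x j \<le> x k}) \<le> real (card A) + 1"
    by simp
  moreover have "real n * u < real (card {j \<in> {1..n}. x j \<le> x k})"
    using k(1) assms(2) by (auto simp: B_def A_def emp_cdf_eq_card pos_less_divide_eq not_le mult.commute)
  ultimately show ?thesis
    by (simp add: A_def)
qed

text \<open>The two index sets are nested, so the sum of absolute differences collapses to a
  difference of cardinalities, and the two counting lemmas control the one that depends on
  ranks.\<close>

lemma sum_abs_emp_cdf_diff_le:
  assumes "inj_on x {1..n}" "n \<ge> 1" "u \<in> {0<..<1}"
  shows "(\<Sum>j=1..n. \<bar>of_bool (emp_cdf x n (x j) \<le> u) - of_bool (x j \<le> t)\<bar>)
    \<le> real n * \<bar>emp_cdf x n t - u\<bar> + 1"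
proof -
  define A where "A = {j \<in> {1..n}. emp_cdf x n (x j) \<le> u}"
  have A: "(\<Sum>j=1..n. of_bool (emp_cdf x n (x j) \<le> u)) = real (card A)"
    by (simp add: A_def sum_of_bool_eq Int_def)
  have T: "(\<Sum>j=1..n. of_bool (x j \<le> t)) = real n * emp_cdf x n t"
    using assms(2) by (simp add: emp_cdf_def)
  show ?thesis
  proof (cases "emp_cdf x n t \<le> u")
    case True
    then have "(\<Sum>j=1..n. \<bar>of_bool (emp_cdf x n (x j) \<le> u) - of_bool (x j \<le> t)\<bar>)
        = (\<Sum>j=1..n. of_bool (emp_cdf x n (x j) \<le> u) - of_bool (x j \<le> t) :: real)"
      by (intro sum.cong) (auto simp: emp_cdf_le_imp)
    also have "\<dots> = card A - real n * emp_cdf x n t"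
      by (simp only: sum_subtractf A T)
    also have "\<dots> \<le> real n * (u - emp_cdf x n t)"
      using card_emp_cdf_le[of n u x] assms by (simp add: A_def algebra_simps)
    also have "\<dots> \<le> real n * \<bar>emp_cdf x n t - u\<bar>"
      by (intro mult_left_mono) auto
    finally show ?thesis by simp
  next
    case False
    then have "(\<Sum>j=1..n. \<bar>of_bool (emp_cdf x n (x j) \<le> u) - of_bool (x j \<le> t)\<bar>)
        = (\<Sum>j=1..n. of_bool (x j \<le> t) - of_bool (emp_cdf x n (x j) \<le> u) :: real)"
      by (intro sum.cong) (auto dest: less_emp_cdf_imp[of u x n t, rotated] simp: not_le)
    also have "\<dots> = real n * emp_cdf x n t - card A"
      by (simp only: sum_subtractf A T)
    also have "\<dots> \<le> real n * \<bar>emp_cdf x n t - u\<bar> + 1"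
    proof (cases "A = {1..n}")
      case True
      \<comment> \<open>The lower count bound is stated for a proper subset of the indices; if every
        index belongs to \<open>A\<close>, the difference is at most zero.\<close>
      have "real n * emp_cdf x n t \<le> n"
        using card_mono[of "{1..n}" "{j \<in> {1..n}. x j \<le> t}"] assms(2)
        by (simp add: emp_cdf_eq_card subset_eq)
      then show ?thesis using True by (simp add: add_increasing)
    next
      case False': False
      have "real n * (emp_cdf x n t - u) \<le> real n * \<bar>emp_cdf x n t - u\<bar>"
        by (intro mult_left_mono) auto
      then show ?thesis
        using card_emp_cdf_ge[OF assms(1,2), of u] False' by (simp add: A_def algebra_simps)
    qed
    finally show ?thesis .
  qed
qed

text \<open>A product of two indicators changes by at most the sum of the changes of its factors.
  Each margin contributes one to the constant 2.\<close>

lemma emp_copula_diff_le: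
  assumes "inj_on x {1..n}" "inj_on y {1..n}" "n \<ge> 1" "u \<in> {0<..<1}" "v \<in> {0<..<1}"
  shows "real n * \<bar>emp_copula x y n u v - (\<Sum>j=1..n. of_bool (x j \<le> s) * of_bool (y j \<le> t)) / real n\<bar>
    \<le> real n * \<bar>emp_cdf x n s - u\<bar> + real n * \<bar>emp_cdf y n t - v\<bar> + 2"
proof -
  have "real n * \<bar>emp_copula x y n u v - (\<Sum>j=1..n. of_bool (x j \<le> s) * of_bool (y j \<le> t)) / real n\<bar>
      = \<bar>\<Sum>j=1..n. of_bool (emp_cdf x n (x j) \<le> u) * of_bool (emp_cdf y n (y j) \<le> v)
          - of_bool (x j \<le> s) * of_bool (y j \<le> t)\<bar>"
    using assms(3) by (simp add: emp_copula_def sum_subtractf flip: diff_divide_distrib)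
  also have "\<dots> \<le> (\<Sum>j=1..n. \<bar>of_bool (emp_cdf x n (x j) \<le> u) - of_bool (x j \<le> s)\<bar>
      + \<bar>of_bool (emp_cdf y n (y j) \<le> v) - of_bool (y j \<le> t)\<bar>)"
    by (intro order.trans[OF sum_abs] sum_mono) (auto simp: of_bool_def)
  also have "\<dots> \<le> (real n * \<bar>emp_cdf x n s - u\<bar> + 1) + (real n * \<bar>emp_cdf y n t - v\<bar> + 1)"
    unfolding sum.distrib using assms by (intro add_mono sum_abs_emp_cdf_diff_le)
  finally show ?thesis by simp
qed

text \<open>The empirical distribution function \<open>g\<close> crosses the level \<open>a\<close> near the grid point \<open>-D / \<delta>\<close>; the
  bracketing points found are up to two steps away from its integer part, hence \<open>L - 3\<close>.\<close>

lemma grid_bracket: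
  fixes g :: "int \<Rightarrow> real"
  assumes "\<delta> > 0" "r > 0" and D: "\<bar>D\<bar> \<le> (real L - 3) * \<delta>"
    and g: "\<And>i. i \<in> {-int L..int L} \<Longrightarrow> \<bar>r * (g i - a) - D - real_of_int i * \<delta>\<bar> \<le> \<delta>"
  obtains i i' where "i \<in> {-int L..int L}" "i' \<in> {-int L..int L}" "g i \<le> a" "a < g i'"
    "\<bar>real_of_int i * \<delta> + D\<bar> \<le> 2 * \<delta>" "\<bar>real_of_int i' * \<delta> + D\<bar> \<le> 2 * \<delta>"
proof -
  define k where "k = \<lfloor>- D / \<delta>\<rfloor>"
  have k: "real_of_int k * \<delta> \<le> - D" "- D < real_of_int k * \<delta> + \<delta>"
    using assms(1) floor_divide_lower[OF assms(1), of "-D"] floor_divide_upper[OF assms(1), of "-D"]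
    by (auto simp: k_def algebra_simps)
  have "\<bar>- D / \<delta>\<bar> \<le> real L - 3"
    using D assms(1) by (simp add: abs_divide pos_divide_le_eq)
  then have kL: "k \<le> int L - 3" "- int L + 2 \<le> k"
    unfolding k_def by linarith+
  \<comment> \<open>Since \<open>k\<close> is a floor, \<open>D + k \<delta>\<close> lies in
    \<open>(- \<delta>, 0]\<close>. One step down absorbs the error \<open>\<delta>\<close> of the
    hypothesis; going up takes two steps to end strictly above the level.\<close>
  have "r * (g (k - 1) - a) \<le> 0"
    using g[of "k - 1"] kL k by (simp add: algebra_simps abs_le_iff)
  then have 1: "g (k - 1) \<le> a"
    using assms(2) by (simp add: mult_le_0_iff)
  have "r * (g (k + 2) - a) > 0"
    using g[of "k + 2"] kL k by (simp add: algebra_simps abs_le_iff)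
  then have 2: "g (k + 2) > a"
    using assms(2) by (simp add: zero_less_mult_iff)
  show ?thesis
    by (rule that[of "k - 1" "k + 2"]) (use kL k 1 2 assms(1) in \<open>auto simp: algebra_simps abs_le_iff\<close>)
qed

section \<open>Differentiability of a copula\<close>

lemma continuous_partials_has_derivative:
  assumes "continuous_partials C" and ab: "a \<in> {0<..<1}" "b \<in> {0<..<1}"
  shows "((\<lambda>(u, v). C u v) has_derivative (\<lambda>(p, q). h1 C a b * p + h2 C a b * q)) (at (a, b))"
proof -
  let ?I = "{0<..<1::real}"
  have deriv1: "((\<lambda>s. C s v) has_real_derivative h1 C u v) (at u)"
    and deriv2: "((\<lambda>t. C u t) has_real_derivative h2 C u v) (at v)" if "u \<in> ?I" "v \<in> ?I" for u v
    using assms(1) that unfolding continuous_partials_def h1_def h2_def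
    by (simp_all add: DERIV_deriv_iff_real_differentiable)
  \<comment> \<open>The criterion for total differentiability takes the first partial derivative at
    \<open>(a, b)\<close> and the second as a bounded linear map that depends continuously on the
    point.\<close>
  have "continuous (at (a, b) within ?I \<times> ?I) (\<lambda>(u, v). h2 C u v)"
    using assms by (auto simp: continuous_partials_def continuous_on_eq_continuous_within)
  then have cont: "continuous (at (a, b) within ?I \<times> ?I) (\<lambda>(u, v). blinfun_scaleR_left (h2 C u v))"
    unfolding continuous_within case_prod_unfold
    by (intro bounded_linear.tendsto[OF bounded_linear_blinfun_scaleR_left])
  have "((\<lambda>(u, v). C u v) has_derivative
      (\<lambda>(p, q). h1 C a b * p + blinfun_scaleR_left (h2 C a b) q)) (at (a, b) within ?I \<times> ?I)"
  proof (rule has_derivative_partialsI)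
    show "((\<lambda>u. C u b) has_derivative (*) (h1 C a b)) (at a within ?I)"
      using deriv1[OF ab] by (auto simp: has_field_derivative_def intro: has_derivative_at_withinI)
    show "((\<lambda>v. C u v) has_derivative blinfun_apply (blinfun_scaleR_left (h2 C u v))) (at v within ?I)"
      if "u \<in> ?I" "v \<in> ?I" for u v
      using deriv2[OF that]
      by (auto simp: has_field_derivative_def mult.commute[of _ "h2 C u v"] intro: has_derivative_at_withinI)
  qed (use ab cont in auto)
  moreover have "at (a, b) within ?I \<times> ?I = at (a, b)"
    using ab by (intro at_within_open open_Times) auto
  ultimately show ?thesis
    by (simp add: mult.commute)
qed

text \<open>The total derivative is taken along the line
  \<open>\<theta> \<mapsto> (a + \<theta> c, b + \<theta> d)\<close>, and the difference quotient at
  \<open>0\<close> is read off along \<open>\<theta> = 1 / sqrt n\<close>.\<close>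

lemma continuous_partials_tendsto:
  assumes "continuous_partials C" and a: "a \<in> {0<..<1}" "b \<in> {0<..<1}"
  shows "(\<lambda>n. sqrt (real n) * (C (a + c / sqrt (real n)) (b + d / sqrt (real n)) - C a b))
    \<longlonglongrightarrow> h1 C a b * c + h2 C a b * d"
proof -
  have "((\<lambda>\<theta>::real. (a + \<theta> * c, b + \<theta> * d)) has_derivative (\<lambda>\<theta>. (\<theta> * c, \<theta> * d))) (at 0)"
    by (auto intro!: derivative_eq_intros)
  moreover have "((\<lambda>(u, v). C u v) has_derivative (\<lambda>(p, q). h1 C a b * p + h2 C a b * q))
      (at (a + 0 * c, b + 0 * d))"
    using continuous_partials_has_derivative[OF assms] by simp
  ultimately have "((\<lambda>(u, v). C u v) \<circ> (\<lambda>\<theta>. (a + \<theta> * c, b + \<theta> * d)) has_derivative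
      (\<lambda>(p, q). h1 C a b * p + h2 C a b * q) \<circ> (\<lambda>\<theta>. (\<theta> * c, \<theta> * d))) (at 0)"
    by (rule diff_chain_at)
  then have "((\<lambda>\<theta>. C (a + \<theta> * c) (b + \<theta> * d)) has_real_derivative
      (h1 C a b * c + h2 C a b * d)) (at 0)"
    by (auto simp: has_field_derivative_def comp_def algebra_simps elim!: has_derivative_eq_rhs)
  then have lim: "((\<lambda>\<theta>. (C (a + \<theta> * c) (b + \<theta> * d) - C a b) / \<theta>) \<longlongrightarrow>
      h1 C a b * c + h2 C a b * d) (at 0)"
    by (simp add: DERIV_def)
  have "filterlim (\<lambda>n. 1 / sqrt (real n)) (at 0) sequentially"
    unfolding filterlim_at
    by (intro conjI tendsto_divide_0[OF tendsto_const]
        filterlim_at_top_imp_at_infinity[OF filterlim_compose[OF sqrt_at_top filterlim_real_sequentially]])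
      (auto intro: eventually_sequentiallyI[of 1])
  from filterlim_compose[OF lim this] show ?thesis
    by (simp add: mult.commute)
qed

lemma lower_tail_dependence_eq_deriv:
  assumes "is_copula C" and lim: "((\<lambda>u. C u u / u) \<longlongrightarrow> l) (at_right 0)"
  shows "lower_tail_dependence C = diagonal_deriv0 C"
proof -
  \<comment> \<open>With value \<open>0\<close> at the origin, \<open>C u u / u\<close> is the
    difference quotient of the diagonal.\<close>
  have "C 0 0 = 0"
    using assms(1) by (auto simp: is_copula_def)
  then have "(diagonal C has_vector_derivative l) (at_right 0)"
    using lim unfolding has_real_derivative_iff_has_vector_derivative[symmetric] has_field_derivative_iff
    by (simp add: diagonal_def)
  then have "diagonal_deriv0 C = l"
    unfolding diagonal_deriv0_def by (intro vector_derivative_within) (auto simp: trivial_limit_at_right_real)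
  moreover have "lower_tail_dependence C = l"
    unfolding lower_tail_dependence_def using lim by (intro tendsto_Lim) auto
  ultimately show ?thesis by simp
qed

section \<open>Moments and quantiles of real random variables\<close>

lemma (in prob_space) square_expectation_le:
  fixes U :: "'a \<Rightarrow> real"
  assumes "integrable M U" "integrable M (\<lambda>\<omega>. (U \<omega>)\<^sup>2)"
  shows "(expectation U)\<^sup>2 \<le> expectation (\<lambda>\<omega>. (U \<omega>)\<^sup>2)"
  using variance_positive[of U] variance_eq[OF assms] by linarith

text \<open>The polynomial \<open>t \<mapsto> E (t U + V)\<^sup>2\<close> is never negative; its
  value at the minimiser \<open>- q / p\<close> gives the bound.\<close>

lemma (in prob_space) Cauchy_Schwarz_expectation:
  fixes U V :: "'a \<Rightarrow> real"
  assumes "integrable M (\<lambda>\<omega>. (U \<omega>)\<^sup>2)" "integrable M (\<lambda>\<omega>. (V \<omega>)\<^sup>2)" "integrable M (\<lambda>\<omega>. U \<omega> * V \<omega>)"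
  shows "(expectation (\<lambda>\<omega>. U \<omega> * V \<omega>))\<^sup>2
    \<le> expectation (\<lambda>\<omega>. (U \<omega>)\<^sup>2) * expectation (\<lambda>\<omega>. (V \<omega>)\<^sup>2)"
proof -
  define p q r where "p = expectation (\<lambda>\<omega>. (U \<omega>)\<^sup>2)" "q = expectation (\<lambda>\<omega>. U \<omega> * V \<omega>)"
    "r = expectation (\<lambda>\<omega>. (V \<omega>)\<^sup>2)"
  have nonneg: "0 \<le> t\<^sup>2 * p + 2 * t * q + r" for t
  proof -
    have "0 \<le> expectation (\<lambda>\<omega>. (t * U \<omega> + V \<omega>)\<^sup>2)"
      by simp
    also have "\<dots> = expectation (\<lambda>\<omega>. t\<^sup>2 * (U \<omega>)\<^sup>2 + 2 * t * (U \<omega> * V \<omega>) + (V \<omega>)\<^sup>2)"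
      by (simp add: power2_eq_square algebra_simps)
    also have "\<dots> = t\<^sup>2 * p + 2 * t * q + r"
      unfolding p_q_r_def using assms by simp
    finally show ?thesis .
  qed
  have "p \<ge> 0"
    by (simp add: p_q_r_def)
  have "q\<^sup>2 \<le> p * r"
  proof (cases "p = 0")
    case True
    have "q = 0"
    proof (rule ccontr)
      assume "q \<noteq> 0"
      \<comment> \<open>For \<open>p = 0\<close> the polynomial is affine, and a nonzero slope would
        let it reach \<open>-1\<close>, at this \<open>t\<close>.\<close>
      define t where "t = - (r + 1) / (2 * q)"
      have "2 * t * q = - r - 1"
        using \<open>q \<noteq> 0\<close> by (simp add: t_def field_simps)
      then show False
        using nonneg[of t] True by simp
    qed
    then show ?thesis using True by simp
  next
    case False
    then show ?thesis
      using nonneg[of "- q / p"] \<open>p \<ge> 0\<close> by (simp add: field_simps power2_eq_square)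
  qed
  then show ?thesis
    by (simp add: p_q_r_def)
qed

lemma (in prob_space) eventually_prob_Union_le:
  assumes "finite I" "\<eta> > 0" and meas: "\<And>i n. i \<in> I \<Longrightarrow> A i n \<in> events"
    and A: "\<And>i \<eta>. i \<in> I \<Longrightarrow> \<eta> > 0 \<Longrightarrow> eventually (\<lambda>n. prob (A i n) \<le> \<eta>) sequentially"
  shows "eventually (\<lambda>n. prob (\<Union>i\<in>I. A i n) \<le> \<eta>) sequentially"
proof -
  \<comment> \<open>The \<open>+ 1\<close> keeps the share positive even for an empty index
    set.\<close>
  define \<eta>' where "\<eta>' = \<eta> / (real (card I) + 1)"
  have \<eta>': "\<eta>' > 0" "real (card I) * \<eta>' \<le> \<eta>"
    using \<open>\<eta> > 0\<close> by (auto simp: \<eta>'_def field_simps)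
  have "eventually (\<lambda>n. \<forall>i\<in>I. prob (A i n) \<le> \<eta>') sequentially"
    using assms(1) A \<eta>' by (intro eventually_ball_finite) auto
  then show ?thesis
  proof eventually_elim
    case (elim n)
    have "prob (\<Union>i\<in>I. A i n) \<le> (\<Sum>i\<in>I. prob (A i n))"
      using assms(1) meas by (intro finite_measure_subadditive_finite) auto
    also have "\<dots> \<le> (\<Sum>i\<in>I. \<eta>')"
      using elim by (intro sum_mono) auto
    also have "\<dots> \<le> \<eta>"
      using \<eta>' by simp
    finally show ?case .
  qed
qed

text \<open>Squares up to \<open>\<epsilon>\<^sup>2\<close> are harmless, squares above
  \<open>B\<close> are dominated by the fourth power divided by \<open>B\<close>, and those in
  between cost at most \<open>B\<close> times a small probability.\<close>

lemma (in prob_space) square_expectation_tendsto_0: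
  fixes R :: "nat \<Rightarrow> 'a \<Rightarrow> real"
  assumes meas: "\<And>n. R n \<in> borel_measurable M"
    and int: "\<And>n. integrable M (\<lambda>\<omega>. R n \<omega> ^ 4)"
    and bound: "\<And>n. n \<ge> 1 \<Longrightarrow> expectation (\<lambda>\<omega>. R n \<omega> ^ 4) \<le> K"
    and prob: "\<And>\<epsilon> \<eta>. \<epsilon> > 0 \<Longrightarrow> \<eta> > 0 \<Longrightarrow>
      eventually (\<lambda>n. prob {\<omega> \<in> space M. \<bar>R n \<omega>\<bar> > \<epsilon>} \<le> \<eta>) sequentially"
  shows "(\<lambda>n. expectation (\<lambda>\<omega>. (R n \<omega>)\<^sup>2)) \<longlonglongrightarrow> 0"
proof (rule order_tendstoI)
  fix e :: real assume "e < 0"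
  show "eventually (\<lambda>n. e < expectation (\<lambda>\<omega>. (R n \<omega>)\<^sup>2)) sequentially"
    by (intro always_eventually allI less_le_trans[OF \<open>e < 0\<close>]) simp
next
  fix e :: real assume "e > 0"
  define \<epsilon> where "\<epsilon> = sqrt (e / 4)"
  have \<epsilon>: "\<epsilon> > 0" "\<epsilon>\<^sup>2 = e / 4"
    using \<open>e > 0\<close> by (auto simp: \<epsilon>_def)
  \<comment> \<open>Chosen so that the fourth moment term costs at most \<open>e / 4\<close>; the
    absolute value and the \<open>+ 1\<close> keep \<open>B\<close> positive for any
    \<open>K\<close>.\<close>
  define B where "B = 4 * (\<bar>K\<bar> + 1) / e"
  have B: "B > 0" "K / B \<le> e / 4"
    using \<open>e > 0\<close> mult_left_mono[of "K / (\<bar>K\<bar> + 1)" 1 "e / 4"]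
    by (auto simp: B_def divide_le_eq mult.commute)
  have "eventually (\<lambda>n. prob {\<omega> \<in> space M. \<bar>R n \<omega>\<bar> > \<epsilon>} \<le> e / (4 * B)) sequentially"
    using \<epsilon> B \<open>e > 0\<close> by (intro prob) auto
  then show "eventually (\<lambda>n. expectation (\<lambda>\<omega>. (R n \<omega>)\<^sup>2) < e) sequentially"
    using eventually_ge_at_top[of 1]
  proof eventually_elim
    case (elim n)
    note [measurable] = meas[of n]
    define S where "S = {\<omega> \<in> space M. \<bar>R n \<omega>\<bar> > \<epsilon>}"
    have [measurable]: "S \<in> events"
      unfolding S_def by measurable
    have *: "(R n \<omega>)\<^sup>2 \<le> \<epsilon>\<^sup>2 + R n \<omega> ^ 4 / B + B * indicator S \<omega>" if "\<omega> \<in> space M" for \<omega>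
    proof (cases "\<omega> \<in> S")
      case False
      then have "(R n \<omega>)\<^sup>2 \<le> \<epsilon>\<^sup>2"
        using that \<epsilon> by (auto simp: S_def not_less abs_le_square_iff[symmetric])
      then show ?thesis
        using False B by (simp add: add_increasing2)
    next
      case True
      have large: "(R n \<omega>)\<^sup>2 \<le> R n \<omega> ^ 4 / B" if "(R n \<omega>)\<^sup>2 > B"
        using mult_right_mono[OF less_imp_le[OF that], of "(R n \<omega>)\<^sup>2"] B
        by (simp add: field_simps power4_eq_xxxx power2_eq_square)
      have "0 \<le> R n \<omega> ^ 4 / B"
        using B by simp
      then have "(R n \<omega>)\<^sup>2 \<le> R n \<omega> ^ 4 / B + B"
        using large B(1) by linarith
      moreover have "indicator S \<omega> = (1 :: real)"
        using True by simp
      ultimately show ?thesis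
        using zero_le_power2[of \<epsilon>] by (metis add_increasing add.assoc mult.right_neutral)
    qed
    have int': "integrable M (\<lambda>\<omega>. \<epsilon>\<^sup>2 + R n \<omega> ^ 4 / B + B * indicator S \<omega>)"
      using int[of n] by (intro Bochner_Integration.integrable_add integrable_divide integrable_mult_right)
        (auto simp: emeasure_eq_measure)
    have "expectation (\<lambda>\<omega>. (R n \<omega>)\<^sup>2)
        \<le> expectation (\<lambda>\<omega>. \<epsilon>\<^sup>2 + R n \<omega> ^ 4 / B + B * indicator S \<omega>)"
      using order.trans[OF zero_le_power2 *] by (intro integral_mono' int' *)
    also have "\<dots> = \<epsilon>\<^sup>2 + expectation (\<lambda>\<omega>. R n \<omega> ^ 4) / B + B * prob S"
      using int[of n]
      by (subst Bochner_Integration.integral_add) (auto simp: prob_space emeasure_eq_measure)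
    also have "\<dots> \<le> e / 4 + K / B + B * (e / (4 * B))"
      using elim B bound[of n] \<epsilon>(2)
      by (intro add_mono divide_right_mono mult_left_mono) (auto simp: S_def)
    also have "\<dots> \<le> e / 4 + e / 4 + e / 4"
      using B \<open>e > 0\<close> by (intro add_mono) auto
    also have "\<dots> < e"
      using \<open>e > 0\<close> by simp
    finally show ?case .
  qed
qed

text \<open>The limits at both infinities put values of the distribution function on either side of
  \<open>u\<close>; the intermediate value theorem does the rest.\<close>

lemma real_distribution_cdf_attains:
  assumes "real_distribution N" "continuous_on UNIV (cdf N)" "u \<in> {0<..<1}"
  shows "\<exists>x. cdf N x = u"
proof -
  interpret real_distribution N by fact
  have "eventually (\<lambda>x. cdf N x < u) at_bot" "eventually (\<lambda>x. u < cdf N x) at_top"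
    using order_tendstoD(2)[OF cdf_lim_at_bot] order_tendstoD(1)[OF cdf_lim_at_top_prob] assms(3)
    by auto
  then obtain a b where ab: "cdf N a < u" "u < cdf N b"
    using eventually_happens'[OF trivial_limit_at_bot_linorder]
      eventually_happens'[OF trivial_limit_at_top_linorder] by meson
  then have "a \<le> b"
    using cdf_nondecreasing[of b a] by linarith
  then show ?thesis
    using IVT'[of "cdf N" a u b] ab assms(2) continuous_on_subset[OF assms(2)] by auto
qed

section \<open>Samples from a copula\<close>

locale copula_sample = prob_space M
  for M :: "'a measure" +
  fixes X Y :: "nat \<Rightarrow> 'a \<Rightarrow> real" and C :: "real \<Rightarrow> real \<Rightarrow> real"
  assumes sample_indep: "indep_vars (\<lambda>_. borel) (\<lambda>j \<omega>. (X j \<omega>, Y j \<omega>)) {1..}"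
    and sample_ident: "\<And>j. j \<ge> 1 \<Longrightarrow>
      distr M borel (\<lambda>\<omega>. (X j \<omega>, Y j \<omega>)) = distr M borel (\<lambda>\<omega>. (X 1 \<omega>, Y 1 \<omega>))"
    and cont_X: "continuous_on UNIV (cdf (distr M borel (X 1)))"
    and cont_Y: "continuous_on UNIV (cdf (distr M borel (Y 1)))"
    and copula: "copula_of M (X 1) (Y 1) C"
    and partials: "continuous_partials C"
begin

sublocale iid_sequence M "\<lambda>j \<omega>. (X j \<omega>, Y j \<omega>)"
  using sample_indep sample_ident by unfold_locales

text \<open>The measurable sets are the Borel sets of the plane as one topological space, so the
  projections are measurable by continuity.\<close>

lemma fst_measurable: "(fst :: real \<times> real \<Rightarrow> real) \<in> borel_measurable borel"
  and snd_measurable: "(snd :: real \<times> real \<Rightarrow> real) \<in> borel_measurable borel"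
  by (intro borel_measurable_continuous_onI continuous_intros)+

lemma X_measurable [measurable]: "j \<ge> 1 \<Longrightarrow> X j \<in> borel_measurable M"
  and Y_measurable [measurable]: "j \<ge> 1 \<Longrightarrow> Y j \<in> borel_measurable M"
  using measurable_compose[OF Z_measurable[of j] fst_measurable]
    measurable_compose[OF Z_measurable[of j] snd_measurable] by auto

definition F :: "real \<Rightarrow> real" where "F = cdf (distr M borel (X 1))"
definition G :: "real \<Rightarrow> real" where "G = cdf (distr M borel (Y 1))"

lemma real_distribution_X: "real_distribution (distr M borel (X 1))"
  and real_distribution_Y: "real_distribution (distr M borel (Y 1))"
  by (auto intro!: real_distribution_distr)

lemma mono_F: "mono F" and mono_G: "mono G"
  unfolding F_def G_def
  using finite_borel_measure.cdf_nondecreasing[OF real_distribution.finite_borel_measure_M]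
    real_distribution_X real_distribution_Y by (auto intro!: monoI)

text \<open>Two one-sided events for the same variable intersect in the event at the smaller
  threshold; these rules push that minimum through the distribution function onto the
  levels.\<close>

lemmas F_min = min_of_mono[OF mono_F, symmetric] and G_min = min_of_mono[OF mono_G, symmetric]

text \<open>Any point where \<open>F\<close> takes the value \<open>u\<close> serves as a quantile:
  where \<open>F\<close> is flat, two choices give events that differ by a null set.\<close>

definition qX :: "real \<Rightarrow> real" where "qX u = (SOME x. F x = u)"
definition qY :: "real \<Rightarrow> real" where "qY u = (SOME x. G x = u)"

lemma F_qX: "u \<in> {0<..<1} \<Longrightarrow> F (qX u) = u"
  unfolding qX_def F_def by (rule someI_ex, rule real_distribution_cdf_attains[OF real_distribution_X cont_X])

lemma G_qY: "u \<in> {0<..<1} \<Longrightarrow> G (qY u) = u"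
  unfolding qY_def G_def by (rule someI_ex, rule real_distribution_cdf_attains[OF real_distribution_Y cont_Y])

text \<open>By independence \<open>(V i, V j)\<close> has a product law, and by Fubini the diagonal
  is null because the law of \<open>V j\<close> has no atoms. The map \<open>p\<close> lets one
  argument serve both \<open>X\<close> and \<open>Y\<close>.\<close>

lemma AE_distinct:
  assumes V_measurable: "\<And>j. j \<ge> 1 \<Longrightarrow> V j \<in> borel_measurable M"
    and V: "\<And>j \<omega>. V j \<omega> = p (X j \<omega>, Y j \<omega>)" "p \<in> borel_measurable borel"
    and cont: "continuous_on UNIV (cdf (distr M borel (V 1)))"
  shows "AE \<omega> in M. inj_on (\<lambda>j. V j \<omega> :: real) {1..n}"
proof -
  have "AE \<omega> in M. V i \<omega> \<noteq> V j \<omega>" if "i \<ge> 1" "j \<ge> 1" "i \<noteq> j" for i j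
  proof -
    have [measurable]: "V i \<in> borel_measurable M" "V j \<in> borel_measurable M"
      using that V_measurable by auto
    have "indep_var borel (p \<circ> (\<lambda>\<omega>. (X i \<omega>, Y i \<omega>))) borel (p \<circ> (\<lambda>\<omega>. (X j \<omega>, Y j \<omega>)))"
      by (rule indep_var_compose[OF indep_var_Z[OF that]]) (use V(2) in auto)
    then have "indep_var borel (V i) borel (V j)"
      by (simp add: comp_def V(1)[symmetric])
    then have prod: "distr M (borel \<Otimes>\<^sub>M borel) (\<lambda>\<omega>. (V i \<omega>, V j \<omega>))
        = distr M borel (V i) \<Otimes>\<^sub>M distr M borel (V j)"
      by (simp add: indep_var_distribution_eq)
    have "V k = p \<circ> (\<lambda>\<omega>. (X k \<omega>, Y k \<omega>))" for k
      by (auto simp: V(1))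
    then have law: "distr M borel (V k) = distr (distr M borel (\<lambda>\<omega>. (X k \<omega>, Y k \<omega>))) borel p"
      if "k \<ge> 1" for k
      using distr_distr[OF V(2) Z_measurable[OF that]] by simp
    \<comment> \<open>Continuity is given for the law of \<open>V 1\<close>, so the absence of atoms
      has to be transferred to \<open>V j\<close>.\<close>
    have same_law: "distr M borel (V j) = distr M borel (V 1)"
      using that by (simp only: law sample_ident[of j] le_refl)
    interpret D: real_distribution "distr M borel (V j)"
      by (rule real_distribution_distr) measurable
    have atom: "emeasure (distr M borel (V j)) {x} = 0" for x
      unfolding D.emeasure_eq_measure using cont D.isCont_cdf[of x]
      by (simp add: same_law continuous_on_eq_continuous_at)
    have sets: "{z. fst z = (snd z :: real)} \<in> sets (borel \<Otimes>\<^sub>M borel)"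
      unfolding borel_prod by (intro borel_closed closed_Collect_eq continuous_intros)
    have pair: "(\<lambda>\<omega>. (V i \<omega>, V j \<omega>)) \<in> M \<rightarrow>\<^sub>M borel \<Otimes>\<^sub>M borel"
      by measurable
    have "(\<lambda>\<omega>. (V i \<omega>, V j \<omega>)) -` {z. fst z = snd z} \<inter> space M = {\<omega> \<in> space M. V i \<omega> = V j \<omega>}"
      by auto
    then have "emeasure M {\<omega> \<in> space M. V i \<omega> = V j \<omega>}
        = emeasure (distr M borel (V i) \<Otimes>\<^sub>M distr M borel (V j)) {z. fst z = snd z}"
      using emeasure_distr[OF pair sets] by (simp only: prod)
    also have "\<dots> = (\<integral>\<^sup>+x. emeasure (distr M borel (V j)) (Pair x -` {z. fst z = snd z}) \<partial>distr M borel (V i))"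
    proof (rule D.emeasure_pair_measure_alt)
      have "sets (distr M borel (V i) \<Otimes>\<^sub>M distr M borel (V j)) = sets (borel \<Otimes>\<^sub>M borel)"
        by (rule sets_pair_measure_cong) (simp_all only: sets_distr)
      then show "{z. fst z = snd z} \<in> sets (distr M borel (V i) \<Otimes>\<^sub>M distr M borel (V j))"
        using sets by simp
    qed
    also have "\<dots> = 0"
      by (simp add: vimage_def atom)
    finally show ?thesis
      by (intro AE_I[where N="{\<omega> \<in> space M. V i \<omega> = V j \<omega>}"]) auto
  qed
  then have "AE \<omega> in M. i \<noteq> j \<longrightarrow> V i \<omega> \<noteq> V j \<omega>" if "i \<ge> 1" "j \<ge> 1" for i j
    using that by (cases "i = j") auto
  then have "AE \<omega> in M. \<forall>i\<in>{1..n}. \<forall>j\<in>{1..n}. i \<noteq> j \<longrightarrow> V i \<omega> \<noteq> V j \<omega>"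
    by (intro AE_finite_allI) (simp_all only: finite_atLeastAtMost atLeastAtMost_iff)
  then show ?thesis
    by (rule eventually_mono) (blast intro: inj_onI)
qed

lemma AE_inj_X: "AE \<omega> in M. inj_on (\<lambda>j. X j \<omega>) {1..n}"
  using cont_X by (intro AE_distinct[where p=fst] X_measurable) (auto simp: fst_measurable snd_measurable)

lemma AE_inj_Y: "AE \<omega> in M. inj_on (\<lambda>j. Y j \<omega>) {1..n}"
  using cont_Y by (intro AE_distinct[where p=snd] Y_measurable) (auto simp: fst_measurable snd_measurable)

section \<open>Indicators at marginal quantiles and their moments\<close>

definition below_X :: "real \<Rightarrow> real \<times> real \<Rightarrow> real" where
  "below_X u z = of_bool (fst z \<le> qX u)"

definition below_Y :: "real \<Rightarrow> real \<times> real \<Rightarrow> real" where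
  "below_Y v z = of_bool (snd z \<le> qY v)"

definition below_XY :: "real \<Rightarrow> real \<Rightarrow> real \<times> real \<Rightarrow> real" where
  "below_XY u v z = below_X u z * below_Y v z"

lemma bdd_below_X: "bdd_borel (below_X u)"
proof (rule bdd_borelI[where B=1])
  note [measurable] = fst_measurable
  show "below_X u \<in> borel_measurable borel"
    unfolding below_X_def[abs_def] of_bool_def by measurable
qed (simp add: below_X_def)

lemma bdd_below_Y: "bdd_borel (below_Y u)"
proof (rule bdd_borelI[where B=1])
  note [measurable] = snd_measurable
  show "below_Y u \<in> borel_measurable borel"
    unfolding below_Y_def[abs_def] of_bool_def by measurable
qed (simp add: below_Y_def)

lemma bdd_below_XY: "bdd_borel (below_XY u v)"
  unfolding below_XY_def[abs_def] by (intro bdd_borel_mult bdd_below_X bdd_below_Y)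

lemmas bdd_below = bdd_below_X bdd_below_Y bdd_below_XY

lemma mean_prob: "mean (\<lambda>z. of_bool (P z)) = prob {\<omega> \<in> space M. P (X 1 \<omega>, Y 1 \<omega>)}"
proof -
  have "mean (\<lambda>z. of_bool (P z)) = expectation (indicator {\<omega> \<in> space M. P (X 1 \<omega>, Y 1 \<omega>)})"
    unfolding mean_def by (intro Bochner_Integration.integral_cong) (auto simp: indicator_def)
  also have "\<dots> = prob ({\<omega> \<in> space M. P (X 1 \<omega>, Y 1 \<omega>)} \<inter> space M)"
    by simp
  also have "{\<omega> \<in> space M. P (X 1 \<omega>, Y 1 \<omega>)} \<inter> space M = {\<omega> \<in> space M. P (X 1 \<omega>, Y 1 \<omega>)}"
    by auto
  finally show ?thesis .
qed

lemma mean_le_fst: "mean (\<lambda>z. of_bool (fst z \<le> x)) = F x"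
  unfolding mean_prob cdf_def F_def G_def
  by (subst measure_distr) (auto intro!: arg_cong[where f=prob])

lemma mean_le_snd: "mean (\<lambda>z. of_bool (snd z \<le> x)) = G x"
  unfolding mean_prob cdf_def F_def G_def
  by (subst measure_distr) (auto intro!: arg_cong[where f=prob])

lemma mean_le_both: "mean (\<lambda>z. of_bool (fst z \<le> x \<and> snd z \<le> y)) = C (F x) (G y)"
  using copula by (simp add: mean_prob copula_of_def F_def G_def)

lemma mean_below:
  assumes "u \<in> {0<..<1}"
  shows "mean (below_X u) = u" "mean (below_Y u) = u"
  using mean_le_fst[of "qX u"] mean_le_snd[of "qY u"] F_qX[OF assms] G_qY[OF assms]
  by (simp_all add: below_X_def[abs_def] below_Y_def[abs_def])

lemma mean_below_XY:
  assumes "u \<in> {0<..<1}" "v \<in> {0<..<1}"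
  shows "mean (below_XY u v) = C u v"
  using mean_le_both[of "qX u" "qY v"] F_qX[OF assms(1)] G_qY[OF assms(2)]
  by (simp add: below_XY_def[abs_def] below_X_def below_Y_def flip: of_bool_conj)

lemma mean_mult:
  assumes "u \<in> {0<..<1}" "v \<in> {0<..<1}"
  shows "mean (\<lambda>z. below_X u z * below_X v z) = min u v"
    and "mean (\<lambda>z. below_Y u z * below_Y v z) = min u v"
    and "mean (\<lambda>z. below_X u z * below_Y v z) = C u v"
  using mean_le_fst[of "min (qX u) (qX v)"] mean_le_snd[of "min (qY u) (qY v)"] mean_below_XY[OF assms]
    F_qX[OF assms(1)] G_qY[OF assms(1)] F_qX[OF assms(2)] G_qY[OF assms(2)]
  by (simp_all add: F_min G_min below_XY_def[abs_def] below_X_def below_Y_def flip: of_bool_conj)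

lemma mean_mult_XY:
  assumes "u \<in> {0<..<1}" "v \<in> {0<..<1}" "w \<in> {0<..<1}"
  shows "mean (\<lambda>z. below_XY u v z * below_X w z) = C (min u w) v"
    and "mean (\<lambda>z. below_XY u v z * below_Y w z) = C u (min v w)"
  using mean_le_both[of "min (qX u) (qX w)" "qY v"] mean_le_both[of "qX u" "min (qY v) (qY w)"]
    F_qX[OF assms(1)] G_qY[OF assms(2)] F_qX[OF assms(3)] G_qY[OF assms(3)]
  by (simp_all add: F_min G_min below_XY_def below_X_def below_Y_def conj_ac flip: of_bool_conj)

lemma mean_mult_XY_XY:
  assumes "u \<in> {0<..<1}" "v \<in> {0<..<1}" "w \<in> {0<..<1}" "t \<in> {0<..<1}"
  shows "mean (\<lambda>z. below_XY u v z * below_XY w t z) = C (min u w) (min v t)"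
  using mean_le_both[of "min (qX u) (qX w)" "min (qY v) (qY t)"]
    F_qX[OF assms(1)] G_qY[OF assms(2)] F_qX[OF assms(3)] G_qY[OF assms(4)]
  by (simp add: F_min G_min below_XY_def below_X_def below_Y_def conj_ac flip: of_bool_conj)

text \<open>The squared difference is the indicator of a strip between two quantiles. Its mean will
  bound the variance of the increments of the empirical process.\<close>

lemma mean_square_diff:
  assumes "u \<in> {0<..<1}" "v \<in> {0<..<1}"
  shows "mean (\<lambda>z. (below_X u z - below_X v z)\<^sup>2) = \<bar>u - v\<bar>"
    and "mean (\<lambda>z. (below_Y u z - below_Y v z)\<^sup>2) = \<bar>u - v\<bar>"
proof -
  have "mean (\<lambda>z. (below_X u z - below_X v z)\<^sup>2)
      = mean (\<lambda>z. below_X u z + below_X v z - 2 * (below_X u z * below_X v z))"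
    by (intro arg_cong[where f=mean]) (auto simp: below_X_def of_bool_def)
  also have "\<dots> = u + v - 2 * min u v"
    using assms
    by (simp add: mean_diff mean_add mean_cmult mean_below mean_mult bdd_below bdd_borel_intros)
  finally show "mean (\<lambda>z. (below_X u z - below_X v z)\<^sup>2) = \<bar>u - v\<bar>"
    by (simp add: min_def)
  have "mean (\<lambda>z. (below_Y u z - below_Y v z)\<^sup>2)
      = mean (\<lambda>z. below_Y u z + below_Y v z - 2 * (below_Y u z * below_Y v z))"
    by (intro arg_cong[where f=mean]) (auto simp: below_Y_def of_bool_def)
  also have "\<dots> = u + v - 2 * min u v"
    using assms
    by (simp add: mean_diff mean_add mean_cmult mean_below mean_mult bdd_below bdd_borel_intros)
  finally show "mean (\<lambda>z. (below_Y u z - below_Y v z)\<^sup>2) = \<bar>u - v\<bar>"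
    by (simp add: min_def)
qed

text \<open>For values in \<open>{0, 1}\<close>, the squared change of a product is at most the sum
  of the squared changes of its factors.\<close>

lemma mean_square_diff_XY:
  assumes "u \<in> {0<..<1}" "v \<in> {0<..<1}" "w \<in> {0<..<1}" "t \<in> {0<..<1}"
  shows "mean (\<lambda>z. (below_XY u v z - below_XY w t z)\<^sup>2) \<le> \<bar>u - w\<bar> + \<bar>v - t\<bar>"
proof -
  have "mean (\<lambda>z. (below_XY u v z - below_XY w t z)\<^sup>2)
      \<le> mean (\<lambda>z. (below_X u z - below_X w z)\<^sup>2 + (below_Y v z - below_Y t z)\<^sup>2)"
    unfolding power2_eq_square
    by (intro mean_mono bdd_borel_intros bdd_below)
       (auto simp: below_XY_def below_X_def below_Y_def of_bool_def)
  also have "\<dots> = \<bar>u - w\<bar> + \<bar>v - t\<bar>"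
    using assms mean_square_diff
    by (simp add: mean_add power2_eq_square bdd_borel_intros bdd_below)
  finally show ?thesis .
qed

text \<open>The influence function of the empirical copula on the diagonal: the two subtracted terms
  correct, to first order, for the estimation of the marginal quantiles from the same
  sample.\<close>

definition influence :: "real \<Rightarrow> real \<times> real \<Rightarrow> real" where
  "influence u z = below_XY u u z - h1 C u u * below_X u z - h2 C u u * below_Y u z"

lemma bdd_influence: "bdd_borel (influence u)"
  unfolding influence_def[abs_def] by (intro bdd_borel_intros bdd_below)

lemma cov_influence:
  assumes u: "u \<in> {0<..<1}" and v: "v \<in> {0<..<1}"
  shows "cov (influence u) (influence v) = K_kernel C u v"
proof -
  note bdd = bdd_below bdd_borel_intros
  \<comment> \<open>Orients the mixed covariances so that, after the bilinear expansion, only the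
    nine forms of \<open>cov_eqs\<close> remain.\<close>
  have swap: "cov (below_X p) (below_XY r r) = cov (below_XY r r) (below_X p)"
    "cov (below_Y p) (below_XY r r) = cov (below_XY r r) (below_Y p)"
    "cov (below_Y p) (below_X r) = cov (below_X r) (below_Y p)" for p r
    by (rule cov_commute)+
  have cov_eqs: "cov (below_XY u u) (below_XY v v) = C (min u v) (min u v) - C u u * C v v"
    "cov (below_XY u u) (below_X v) = C (min u v) u - C u u * v"
    "cov (below_XY u u) (below_Y v) = C u (min u v) - C u u * v"
    "cov (below_XY v v) (below_X u) = C (min v u) v - C v v * u"
    "cov (below_XY v v) (below_Y u) = C v (min v u) - C v v * u"
    "cov (below_X u) (below_X v) = min u v - u * v"
    "cov (below_Y u) (below_Y v) = min u v - u * v"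
    "cov (below_X u) (below_Y v) = C u v - u * v"
    "cov (below_X v) (below_Y u) = C v u - v * u"
    using u v by (simp_all add: cov_def mean_mult mean_mult_XY mean_mult_XY_XY mean_below mean_below_XY)
  show ?thesis
    unfolding influence_def[abs_def] K_kernel_def diagonal_def
    by (simp add: cov_diff_left cov_diff_right bdd cov_cmult_left cov_cmult_right swap cov_eqs)
       (simp add: algebra_simps min.commute[of v u])
qed

section \<open>Linearisation of the empirical copula\<close>

definition emp_diag :: "real \<Rightarrow> nat \<Rightarrow> 'a \<Rightarrow> real" where
  "emp_diag u n \<omega> = emp_copula (\<lambda>j. X j \<omega>) (\<lambda>j. Y j \<omega>) n u u"

definition remainder :: "real \<Rightarrow> nat \<Rightarrow> 'a \<Rightarrow> real" where
  "remainder u n \<omega> =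
     sqrt (real n) * (emp_diag u n \<omega> - C u u) - csum n (influence u) \<omega> / sqrt (real n)"

lemma csum_influence:
  "csum n (influence u) \<omega> =
     csum n (below_XY u u) \<omega> - h1 C u u * csum n (below_X u) \<omega> - h2 C u u * csum n (below_Y u) \<omega>"
  unfolding influence_def[abs_def]
  by (simp add: csum_diff csum_cmult bdd_below bdd_borel_intros)

lemma emp_diag_measurable: "emp_diag u n \<in> borel_measurable M"
  unfolding emp_diag_def emp_copula_def emp_cdf_def of_bool_def by measurable

lemma emp_diag_bounded: "\<bar>emp_diag u n \<omega>\<bar> \<le> 1"
proof -
  have "(\<Sum>j=1..n. of_bool (emp_cdf (\<lambda>j. X j \<omega>) n (X j \<omega>) \<le> u)
      * of_bool (emp_cdf (\<lambda>j. Y j \<omega>) n (Y j \<omega>) \<le> u)) \<le> (\<Sum>j=1..n. 1 :: real)"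
    by (intro sum_mono) (auto simp: of_bool_def)
  then show ?thesis
    by (auto simp: emp_diag_def emp_copula_def divide_le_eq sum_nonneg)
qed

lemma remainder_measurable: "remainder u n \<in> borel_measurable M"
  unfolding remainder_def using emp_diag_measurable[of u n] csum_measurable[OF bdd_influence, of n u]
  by measurable

text \<open>A crude bound that grows with \<open>n\<close>; it serves integrability, while control
  uniform in \<open>n\<close> comes from the fourth moment.\<close>

lemma remainder_bounded: obtains B where "B \<ge> 0" "\<And>\<omega>. \<bar>remainder u n \<omega>\<bar> \<le> B"
proof -
  obtain B where B: "B \<ge> 0" "\<And>\<omega>. \<bar>csum n (influence u) \<omega>\<bar> \<le> B"
    using csum_bounded[OF bdd_influence] by metis
  have "\<bar>remainder u n \<omega>\<bar> \<le> sqrt n * (1 + \<bar>C u u\<bar>) + B / sqrt n" for \<omega>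
    unfolding remainder_def using B(2)[of \<omega>] emp_diag_bounded[of u n \<omega>]
    by (intro order.trans[OF abs_triangle_ineq4] add_mono)
       (auto simp: abs_mult intro!: mult_left_mono divide_right_mono order.trans[OF abs_triangle_ineq4])
  then show ?thesis
    using B(1) by (intro that[of "sqrt n * (1 + \<bar>C u u\<bar>) + B / sqrt n"]) auto
qed

lemma remainder_power_integrable: "integrable M (\<lambda>\<omega>. remainder u n \<omega> ^ p)"
proof -
  obtain B where "\<And>\<omega>. \<bar>remainder u n \<omega>\<bar> \<le> B"
    using remainder_bounded by metis
  then have "\<bar>remainder u n \<omega> ^ p\<bar> \<le> B ^ p" for \<omega>
    unfolding power_abs by (intro power_mono) auto
  then show ?thesis
    using remainder_measurable[of u n] by (intro integrable_bdd[where B="B ^ p"]) auto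
qed

section \<open>Domination of the remainder and its fourth moment\<close>

lemma sum_below_XY:
  assumes "u \<in> {0<..<1}" "v \<in> {0<..<1}"
  shows "(\<Sum>j=1..n. of_bool (X j \<omega> \<le> qX u) * of_bool (Y j \<omega> \<le> qY v))
    = csum n (below_XY u v) \<omega> + real n * C u v"
  using assms by (simp add: csum_def mean_below_XY sum_subtractf)
    (simp add: below_XY_def below_X_def below_Y_def)

lemma emp_cdf_quantile:
  assumes "u \<in> {0<..<1}" "n \<ge> 1"
  shows "real n * emp_cdf (\<lambda>j. X j \<omega>) n (qX u) = csum n (below_X u) \<omega> + real n * u"
    and "real n * emp_cdf (\<lambda>j. Y j \<omega>) n (qY u) = csum n (below_Y u) \<omega> + real n * u"
  using assms by (simp_all add: csum_def mean_below sum_subtractf emp_cdf_def)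
    (simp_all add: below_X_def below_Y_def)

text \<open>With the thresholds fixed at \<open>qX u\<close> and \<open>qY u\<close>, replacing
  ranks costs no more than the two marginal deviations plus a constant. The remainder is thus
  dominated by centred sums with known fourth moments.\<close>

lemma remainder_le_no_ties:
  assumes u: "u \<in> {0<..<1}" and n: "n \<ge> 1"
    and inj: "inj_on (\<lambda>j. X j \<omega>) {1..n}" "inj_on (\<lambda>j. Y j \<omega>) {1..n}"
  shows "\<bar>remainder u n \<omega>\<bar> \<le> (1 + \<bar>h1 C u u\<bar>) * \<bar>csum n (below_X u) \<omega> / sqrt n\<bar>
    + (1 + \<bar>h2 C u u\<bar>) * \<bar>csum n (below_Y u) \<omega> / sqrt n\<bar> + 2"
proof -
  define S where "S = csum n (below_XY u u) \<omega>"
  define SX where "SX = csum n (below_X u) \<omega>"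
  define SY where "SY = csum n (below_Y u) \<omega>"
  have sqrt: "sqrt n > 0" "sqrt n * sqrt n = real n" "sqrt n \<ge> 1"
    using n by auto
  have X: "real n * \<bar>emp_cdf (\<lambda>j. X j \<omega>) n (qX u) - u\<bar> = \<bar>SX\<bar>"
  proof -
    have "real n * \<bar>emp_cdf (\<lambda>j. X j \<omega>) n (qX u) - u\<bar>
        = \<bar>real n * emp_cdf (\<lambda>j. X j \<omega>) n (qX u) - real n * u\<bar>"
      by (simp add: abs_mult flip: right_diff_distrib)
    then show ?thesis
      using emp_cdf_quantile(1)[OF u n, of \<omega>] by (simp add: SX_def)
  qed
  have Y: "real n * \<bar>emp_cdf (\<lambda>j. Y j \<omega>) n (qY u) - u\<bar> = \<bar>SY\<bar>"
  proof -
    have "real n * \<bar>emp_cdf (\<lambda>j. Y j \<omega>) n (qY u) - u\<bar>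
        = \<bar>real n * emp_cdf (\<lambda>j. Y j \<omega>) n (qY u) - real n * u\<bar>"
      by (simp add: abs_mult flip: right_diff_distrib)
    then show ?thesis
      using emp_cdf_quantile(2)[OF u n, of \<omega>] by (simp add: SY_def)
  qed
  have "real n * \<bar>emp_diag u n \<omega> - (S + real n * C u u) / real n\<bar> \<le> \<bar>SX\<bar> + \<bar>SY\<bar> + 2"
    using emp_copula_diff_le[OF inj n u u, of "qX u" "qY u"]
    by (simp only: X Y sum_below_XY[OF u u] emp_diag_def S_def)
  moreover have "real n * \<bar>emp_diag u n \<omega> - (S + real n * C u u) / real n\<bar>
      = sqrt n * \<bar>sqrt n * (emp_diag u n \<omega> - C u u) - S / sqrt n\<bar>"
  proof -
    have "sqrt n * (emp_diag u n \<omega> - C u u) - S / sqrt n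
        = sqrt n * (emp_diag u n \<omega> - (S + real n * C u u) / real n)"
      using sqrt by (simp add: field_simps)
    then show ?thesis
      using sqrt by (simp add: abs_mult flip: mult.assoc)
  qed
  ultimately have "\<bar>sqrt n * (emp_diag u n \<omega> - C u u) - S / sqrt n\<bar> \<le> (\<bar>SX\<bar> + \<bar>SY\<bar> + 2) / sqrt n"
    using sqrt by (simp add: pos_le_divide_eq mult.commute)
  \<comment> \<open>The last term uses \<open>2 / sqrt n \<le> 2\<close>, valid since
    \<open>sqrt n \<ge> 1\<close>.\<close>
  also have "\<dots> \<le> \<bar>SX / sqrt n\<bar> + \<bar>SY / sqrt n\<bar> + 2"
    using sqrt by (simp add: add_divide_distrib abs_divide divide_le_eq)
  finally have "\<bar>sqrt n * (emp_diag u n \<omega> - C u u) - S / sqrt n\<bar>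
      \<le> \<bar>SX / sqrt n\<bar> + \<bar>SY / sqrt n\<bar> + 2" .
  moreover have "remainder u n \<omega> = (sqrt n * (emp_diag u n \<omega> - C u u) - S / sqrt n)
      + h1 C u u * (SX / sqrt n) + h2 C u u * (SY / sqrt n)"
    by (simp add: remainder_def csum_influence S_def SX_def SY_def diff_divide_distrib)
  moreover have triangle: "\<bar>x + y + z\<bar> \<le> B + \<bar>y\<bar> + \<bar>z\<bar>" if "\<bar>x\<bar> \<le> B" for x y z B :: real
    using that by linarith
  ultimately have "\<bar>remainder u n \<omega>\<bar> \<le> (\<bar>SX / sqrt n\<bar> + \<bar>SY / sqrt n\<bar> + 2)
      + \<bar>h1 C u u\<bar> * \<bar>SX / sqrt n\<bar> + \<bar>h2 C u u\<bar> * \<bar>SY / sqrt n\<bar>"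
    unfolding abs_mult[symmetric] by (simp only: triangle)
  then show ?thesis
    by (simp add: SX_def SY_def algebra_simps add_divide_distrib)
qed

text \<open>Ties have probability zero, so the pathwise bound may be integrated; fourth moments of
  order \<open>n\<^sup>2\<close> are divided by the fourth power of \<open>sqrt n\<close>, which
  removes the dependence on \<open>n\<close>.\<close>

lemma remainder_power4_bound:
  assumes u: "u \<in> {0<..<1}"
  obtains K where "\<And>n. n \<ge> 1 \<Longrightarrow> expectation (\<lambda>\<omega>. remainder u n \<omega> ^ 4) \<le> K"
proof -
  define c where "c = 1 + \<bar>h1 C u u\<bar> + \<bar>h2 C u u\<bar>"
  have c: "c \<ge> 1" "1 + \<bar>h1 C u u\<bar> \<le> c" "1 + \<bar>h2 C u u\<bar> \<le> c"
    by (auto simp: c_def)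
  \<comment> \<open>The bound on the square of a three-term sum is applied twice, whence the
    constant \<open>3\<^sup>2 * 3\<close>.\<close>
  have power4_sum: "(x + y + z) ^ 4 \<le> 27 * (x ^ 4 + y ^ 4 + z ^ 4)" for x y z :: real
  proof -
    have *: "(x + y + z)\<^sup>2 \<le> 3 * (x\<^sup>2 + y\<^sup>2 + z\<^sup>2)" for x y z :: real
      using sum_squares_ge_zero[of "x - y" "y - z"] zero_le_power2[of "x - z"]
      by (simp add: power2_eq_square algebra_simps)
    have "(x + y + z) ^ 4 = ((x + y + z)\<^sup>2)\<^sup>2"
      by simp
    also have "\<dots> \<le> (3 * (x\<^sup>2 + y\<^sup>2 + z\<^sup>2))\<^sup>2"
      by (intro power_mono *) auto
    also have "\<dots> \<le> 9 * (3 * ((x\<^sup>2)\<^sup>2 + (y\<^sup>2)\<^sup>2 + (z\<^sup>2)\<^sup>2))"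
      unfolding power_mult_distrib using *[of "x\<^sup>2" "y\<^sup>2" "z\<^sup>2"] by simp
    finally show ?thesis by simp
  qed
  have "expectation (\<lambda>\<omega>. remainder u n \<omega> ^ 4) \<le> 27 * (c ^ 4 * 3 + c ^ 4 * 3 + 16)" if n: "n \<ge> 1" for n
  proof -
    have bound: "AE \<omega> in M. remainder u n \<omega> ^ 4 \<le>
        27 * (c ^ 4 * (csum n (below_X u) \<omega> ^ 4 / (real n)\<^sup>2)
          + c ^ 4 * (csum n (below_Y u) \<omega> ^ 4 / (real n)\<^sup>2) + 16)"
      using AE_inj_X[of n] AE_inj_Y[of n]
    proof eventually_elim
      case (elim \<omega>)
      define p where "p = csum n (below_X u) \<omega> / sqrt n"
      define q where "q = csum n (below_Y u) \<omega> / sqrt n"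
      have p4: "p ^ 4 = csum n (below_X u) \<omega> ^ 4 / (real n)\<^sup>2" "q ^ 4 = csum n (below_Y u) \<omega> ^ 4 / (real n)\<^sup>2"
        using power_mult[of "sqrt (real n)" 2 2] by (simp_all add: p_def q_def power_divide)
      have "\<bar>remainder u n \<omega>\<bar> \<le> c * \<bar>p\<bar> + c * \<bar>q\<bar> + 2"
        using remainder_le_no_ties[OF u n elim] mult_right_mono[OF c(2), of "\<bar>p\<bar>"]
          mult_right_mono[OF c(3), of "\<bar>q\<bar>"] by (simp add: p_def q_def)
      then have "\<bar>remainder u n \<omega>\<bar> ^ 4 \<le> (c * \<bar>p\<bar> + c * \<bar>q\<bar> + 2) ^ 4"
        by (intro power_mono) auto
      also have "\<dots> \<le> 27 * ((c * \<bar>p\<bar>) ^ 4 + (c * \<bar>q\<bar>) ^ 4 + 2 ^ 4)"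
        by (rule power4_sum)
      finally show ?case
        by (simp add: power_mult_distrib power_even_abs p4)
    qed
    have E4: "expectation (\<lambda>\<omega>. csum n (below_X u) \<omega> ^ 4) / (real n)\<^sup>2 \<le> 3"
      "expectation (\<lambda>\<omega>. csum n (below_Y u) \<omega> ^ 4) / (real n)\<^sup>2 \<le> 3"
      using n expectation_csum_power4[OF bdd_below_X, of u n] expectation_csum_power4[OF bdd_below_Y, of u n]
      by (simp_all add: below_X_def below_Y_def divide_le_eq)
    have int: "integrable M (\<lambda>\<omega>. csum n (below_X u) \<omega> ^ 4)" "integrable M (\<lambda>\<omega>. csum n (below_Y u) \<omega> ^ 4)"
      by (intro csum_power_integrable bdd_below)+
    have "expectation (\<lambda>\<omega>. remainder u n \<omega> ^ 4) \<le> expectation (\<lambda>\<omega>.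
        27 * (c ^ 4 * (csum n (below_X u) \<omega> ^ 4 / (real n)\<^sup>2)
          + c ^ 4 * (csum n (below_Y u) \<omega> ^ 4 / (real n)\<^sup>2) + 16))"
      using int by (intro integral_mono_AE bound remainder_power_integrable) simp
    also have "\<dots> = 27 * (c ^ 4 * (expectation (\<lambda>\<omega>. csum n (below_X u) \<omega> ^ 4) / (real n)\<^sup>2)
        + c ^ 4 * (expectation (\<lambda>\<omega>. csum n (below_Y u) \<omega> ^ 4) / (real n)\<^sup>2) + 16)"
      using int by (simp add: prob_space)
    also have "\<dots> \<le> 27 * (c ^ 4 * 3 + c ^ 4 * 3 + 16)"
      using c by (intro mult_left_mono add_mono E4) auto
    finally show ?thesis .
  qed
  then show ?thesis
    using that by blast
qed

text \<open>A deterministic estimate at one sample point. In units of \<open>1 / sqrt n\<close>, the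
  grid points that bracket the level \<open>a\<close> lie within \<open>2 \<delta>\<close> of
  \<open>- D\<close> and \<open>- E\<close>, the negated marginal errors, and the empirical copula
  lies between the joint frequencies at the lower and the upper grid points. Each frequency is close
  to the linear part: one \<open>\<delta>\<close> pays for the oscillation of the sum, one for the
  expansion of \<open>C\<close>, and \<open>2 \<delta>\<close> times the partial derivative for each
  margin.\<close>

lemma remainder_le_grid:
  fixes s :: "int \<Rightarrow> real" and L :: nat
  assumes a: "a \<in> {0<..<1}" and n: "n \<ge> 1" and \<delta>: "\<delta> > 0"
  defines "I \<equiv> {- int L..int L}"
  assumes s: "\<And>i. s i = a + real_of_int i * \<delta> / sqrt n"
    and s01: "\<And>i. i \<in> I \<Longrightarrow> s i \<in> {0<..<1}"
    and osc_X: "\<And>i. i \<in> I \<Longrightarrow> \<bar>csum n (below_X (s i)) \<omega> - csum n (below_X a) \<omega>\<bar> \<le> \<delta> * sqrt n"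
    and osc_Y: "\<And>i. i \<in> I \<Longrightarrow> \<bar>csum n (below_Y (s i)) \<omega> - csum n (below_Y a) \<omega>\<bar> \<le> \<delta> * sqrt n"
    and osc_XY: "\<And>i j. i \<in> I \<Longrightarrow> j \<in> I \<Longrightarrow>
      \<bar>csum n (below_XY (s i) (s j)) \<omega> - csum n (below_XY a a) \<omega>\<bar> \<le> \<delta> * sqrt n"
    and X: "\<bar>csum n (below_X a) \<omega>\<bar> \<le> (real L - 3) * \<delta> * sqrt n"
    and Y: "\<bar>csum n (below_Y a) \<omega>\<bar> \<le> (real L - 3) * \<delta> * sqrt n"
    and C: "\<And>i j. i \<in> I \<Longrightarrow> j \<in> I \<Longrightarrow>
      \<bar>sqrt n * (C (s i) (s j) - C a a) - (h1 C a a * (i * \<delta>) + h2 C a a * (j * \<delta>))\<bar> \<le> \<delta>"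
  shows "\<bar>remainder a n \<omega>\<bar> \<le> (2 + 2 * \<bar>h1 C a a\<bar> + 2 * \<bar>h2 C a a\<bar>) * \<delta>"
proof -
  define r where "r = sqrt (real n)"
  have r: "r > 0" "r * r = real n"
    using n by (auto simp: r_def)
  define D where "D = csum n (below_X a) \<omega> / r"
  define E where "E = csum n (below_Y a) \<omega> / r"
  define T where "T = csum n (below_XY a a) \<omega> / r"
  let ?x = "\<lambda>j. X j \<omega>" and ?y = "\<lambda>j. Y j \<omega>"
  have s': "real n * s i = real n * a + r * (real_of_int i * \<delta>)" for i
    using r by (simp add: s r_def[symmetric] field_simps)
  have D: "\<bar>D\<bar> \<le> (real L - 3) * \<delta>" and E: "\<bar>E\<bar> \<le> (real L - 3) * \<delta>"
    using X Y r by (simp_all add: D_def E_def abs_divide pos_divide_le_eq r_def[symmetric])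
  \<comment> \<open>The empirical margin moves linearly along the grid up to the oscillation
    \<open>\<delta>\<close>, which is the hypothesis of \<open>grid_bracket\<close>.\<close>
  have gX: "\<bar>r * (emp_cdf ?x n (qX (s i)) - a) - D - real_of_int i * \<delta>\<bar> \<le> \<delta>" if "i \<in> I" for i
  proof -
    have "r * (r * (emp_cdf ?x n (qX (s i)) - a) - D - real_of_int i * \<delta>)
        = csum n (below_X (s i)) \<omega> - csum n (below_X a) \<omega>"
      using emp_cdf_quantile(1)[OF s01[OF that] n, of \<omega>] r s'[of i]
      by (simp add: right_diff_distrib D_def flip: mult.assoc)
    then have "\<bar>r * (r * (emp_cdf ?x n (qX (s i)) - a) - D - real_of_int i * \<delta>)\<bar> \<le> r * \<delta>"
      using osc_X[OF that] by (simp only: r_def mult.commute)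
    then show ?thesis
      unfolding abs_mult using r by simp
  qed
  have gY: "\<bar>r * (emp_cdf ?y n (qY (s i)) - a) - E - real_of_int i * \<delta>\<bar> \<le> \<delta>" if "i \<in> I" for i
  proof -
    have "r * (r * (emp_cdf ?y n (qY (s i)) - a) - E - real_of_int i * \<delta>)
        = csum n (below_Y (s i)) \<omega> - csum n (below_Y a) \<omega>"
      using emp_cdf_quantile(2)[OF s01[OF that] n, of \<omega>] r s'[of i]
      by (simp add: right_diff_distrib E_def flip: mult.assoc)
    then have "\<bar>r * (r * (emp_cdf ?y n (qY (s i)) - a) - E - real_of_int i * \<delta>)\<bar> \<le> r * \<delta>"
      using osc_Y[OF that] by (simp only: r_def mult.commute)
    then show ?thesis
      unfolding abs_mult using r by simp
  qed
  obtain i i' where i: "i \<in> I" "i' \<in> I" "emp_cdf ?x n (qX (s i)) \<le> a" "a < emp_cdf ?x n (qX (s i'))"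
    "\<bar>real_of_int i * \<delta> + D\<bar> \<le> 2 * \<delta>" "\<bar>real_of_int i' * \<delta> + D\<bar> \<le> 2 * \<delta>"
    using grid_bracket[OF \<delta> r(1) D, of "\<lambda>i. emp_cdf ?x n (qX (s i))" a] gX unfolding I_def by metis
  obtain j j' where j: "j \<in> I" "j' \<in> I" "emp_cdf ?y n (qY (s j)) \<le> a" "a < emp_cdf ?y n (qY (s j'))"
    "\<bar>real_of_int j * \<delta> + E\<bar> \<le> 2 * \<delta>" "\<bar>real_of_int j' * \<delta> + E\<bar> \<le> 2 * \<delta>"
    using grid_bracket[OF \<delta> r(1) E, of "\<lambda>i. emp_cdf ?y n (qY (s i))" a] gY unfolding I_def by metis
  have close: "\<bar>r * ((\<Sum>m=1..n. of_bool (?x m \<le> qX (s k)) * of_bool (?y m \<le> qY (s l))) / real n - C a a)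
      - (T - h1 C a a * D - h2 C a a * E)\<bar> \<le> (2 + 2 * \<bar>h1 C a a\<bar> + 2 * \<bar>h2 C a a\<bar>) * \<delta>"
    if kl: "k \<in> I" "l \<in> I" and kD: "\<bar>real_of_int k * \<delta> + D\<bar> \<le> 2 * \<delta>"
      and lE: "\<bar>real_of_int l * \<delta> + E\<bar> \<le> 2 * \<delta>" for k l
  proof -
    have 1: "\<bar>csum n (below_XY (s k) (s l)) \<omega> / r - T\<bar> \<le> \<delta>"
      using osc_XY[OF kl] r
      by (simp add: T_def abs_divide pos_divide_le_eq r_def[symmetric] flip: diff_divide_distrib)
    have 2: "\<bar>h1 C a a * (real_of_int k * \<delta> + D)\<bar> \<le> \<bar>h1 C a a\<bar> * (2 * \<delta>)"
      unfolding abs_mult by (intro mult_left_mono kD) auto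
    have 3: "\<bar>h2 C a a * (real_of_int l * \<delta> + E)\<bar> \<le> \<bar>h2 C a a\<bar> * (2 * \<delta>)"
      unfolding abs_mult by (intro mult_left_mono lE) auto
    have "r * ((csum n (below_XY (s k) (s l)) \<omega> + real n * C (s k) (s l)) / real n - C a a)
        = csum n (below_XY (s k) (s l)) \<omega> / r + r * (C (s k) (s l) - C a a)"
      using r n by (simp add: add_divide_distrib algebra_simps) (simp add: r(2)[symmetric])
    \<comment> \<open>Adding and subtracting the linear term of \<open>C\<close> splits the error
      into oscillation, expansion error and the distance of the grid point from each marginal
      error.\<close>
    then have "r * ((\<Sum>m=1..n. of_bool (?x m \<le> qX (s k)) * of_bool (?y m \<le> qY (s l))) / real n - C a a)
        - (T - h1 C a a * D - h2 C a a * E)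
      = (csum n (below_XY (s k) (s l)) \<omega> / r - T)
        + (r * (C (s k) (s l) - C a a) - (h1 C a a * (k * \<delta>) + h2 C a a * (l * \<delta>)))
        + h1 C a a * (real_of_int k * \<delta> + D) + h2 C a a * (real_of_int l * \<delta> + E)"
      by (simp only: sum_below_XY s01 kl) (simp add: algebra_simps)
    also have "\<bar>\<dots>\<bar> \<le> \<delta> + \<delta> + \<bar>h1 C a a\<bar> * (2 * \<delta>) + \<bar>h2 C a a\<bar> * (2 * \<delta>)"
      using 1 2 3 C[OF kl, folded r_def] by linarith
    finally show ?thesis
      by (simp add: algebra_simps)
  qed
  have rem: "remainder a n \<omega> = r * (emp_diag a n \<omega> - C a a) - (T - h1 C a a * D - h2 C a a * E)"
    by (simp add: remainder_def csum_influence T_def D_def E_def diff_divide_distrib r_def)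
  have "r * ((\<Sum>m=1..n. of_bool (?x m \<le> qX (s i)) * of_bool (?y m \<le> qY (s j))) / real n - C a a)
      \<le> r * (emp_diag a n \<omega> - C a a)"
    unfolding emp_diag_def using r emp_copula_ge[OF i(3) j(3)]
    by (intro mult_left_mono diff_right_mono) auto
  moreover have "r * (emp_diag a n \<omega> - C a a)
      \<le> r * ((\<Sum>m=1..n. of_bool (?x m \<le> qX (s i')) * of_bool (?y m \<le> qY (s j'))) / real n - C a a)"
    unfolding emp_diag_def using r emp_copula_le[OF i(4) j(4)]
    by (intro mult_left_mono diff_right_mono) auto
  ultimately show ?thesis
    using close[OF i(1) j(1) i(5) j(5)] close[OF i(2) j(2) i(6) j(6)] unfolding rem by linarith
qed

text \<open>Chebyshev's inequality for the centred sum of \<open>f n - g\<close>, whose variance per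
  term is eventually at most \<open>B n\<close>. The summand varies with \<open>n\<close> because
  the grid points do.\<close>

lemma eventually_prob_csum_le:
  assumes bdd: "\<And>n. bdd_borel (f n)" "bdd_borel g" and "\<delta> > 0" "\<eta> > 0"
    and lim: "(\<lambda>n. B n) \<longlonglongrightarrow> 0"
    and B: "eventually (\<lambda>n. mean (\<lambda>z. (f n z - g z)\<^sup>2) \<le> B n) sequentially"
  shows "eventually (\<lambda>n. prob {\<omega> \<in> space M. \<bar>csum n (f n) \<omega> - csum n g \<omega>\<bar> > \<delta> * sqrt n} \<le> \<eta>) sequentially"
proof -
  have "eventually (\<lambda>n. B n < \<eta> * \<delta>\<^sup>2) sequentially"
    using assms by (intro order_tendstoD(2)[OF lim]) auto
  with B show ?thesis
    using eventually_ge_at_top[of 1]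
  proof eventually_elim
    case (elim n)
    define h where "h = (\<lambda>z. f n z - g z)"
    have h: "bdd_borel h"
      unfolding h_def by (intro bdd_borel_diff bdd)
    have [measurable]: "csum n h \<in> borel_measurable M"
      by (rule csum_measurable[OF h])
    have eq: "csum n (f n) \<omega> - csum n g \<omega> = csum n h \<omega>" for \<omega>
      unfolding h_def by (rule csum_diff[OF bdd, symmetric])
    have "prob {\<omega> \<in> space M. \<bar>csum n (f n) \<omega> - csum n g \<omega>\<bar> > \<delta> * sqrt n}
        \<le> prob {\<omega> \<in> space M. \<bar>csum n h \<omega>\<bar> \<ge> \<delta> * sqrt n}"
      unfolding eq by (intro finite_measure_mono) auto
    also have "\<dots> \<le> cov h h / \<delta>\<^sup>2"
      using elim \<open>\<delta> > 0\<close> by (intro prob_csum_le h) auto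
    also have "\<dots> \<le> B n / \<delta>\<^sup>2"
      using elim cov_self_le[of h] by (intro divide_right_mono) (auto simp: h_def)
    also have "\<dots> \<le> \<eta>"
      using elim \<open>\<delta> > 0\<close> by (simp add: divide_le_eq)
    finally show ?case .
  qed
qed

text \<open>The grid estimate applies outside five bad events: three unions of oscillation events
  and two events in which a marginal error leaves the range of the grid. The number of grid points
  does not depend on \<open>n\<close>, so each union is finite and fixed in size.\<close>

lemma remainder_in_probability:
  assumes a: "a \<in> {0<..<1}" and "\<epsilon> > 0" "\<eta> > 0"
  shows "eventually (\<lambda>n. prob {\<omega> \<in> space M. \<bar>remainder a n \<omega>\<bar> > \<epsilon>} \<le> \<eta>) sequentially"
proof -
  define c where "c = 2 + 2 * \<bar>h1 C a a\<bar> + 2 * \<bar>h2 C a a\<bar>"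
  define \<delta> where "\<delta> = \<epsilon> / c"
  have c: "c > 0"
    by (simp add: c_def add_pos_nonneg)
  then have \<delta>: "\<delta> > 0" "c * \<delta> = \<epsilon>"
    using \<open>\<epsilon> > 0\<close> by (auto simp: \<delta>_def)
  \<comment> \<open>Makes the grid reach \<open>K \<ge> 1 + 8 / \<eta>\<close>, hence
    \<open>K\<^sup>2 \<ge> 8 / \<eta>\<close>, so that by Chebyshev each margin escapes with
    probability at most \<open>\<eta> / 8\<close>.\<close>
  obtain L :: nat where L: "real L \<ge> 3 + (1 + 1 / \<eta> * 8) / \<delta>"
    using real_arch_simple by blast
  define K where "K = (real L - 3) * \<delta>"
  have K: "K \<ge> 1 + 8 / \<eta>"
    using L \<delta> by (simp add: K_def field_simps)
  have "8 / \<eta> > 0"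
    using \<open>\<eta> > 0\<close> by simp
  then have "K > 0" "8 / \<eta> \<le> K" "1 \<le> K"
    using K by linarith+
  then have "8 / \<eta> * 1 \<le> K * K"
    using \<open>8 / \<eta> > 0\<close> by (intro mult_mono) auto
  then have tail: "1 / K\<^sup>2 \<le> \<eta> / 8"
    using \<open>K > 0\<close> \<open>\<eta> > 0\<close> by (simp add: field_simps power2_eq_square)
  define I where "I = {- int L..int L}"
  have fin: "finite I"
    by (simp add: I_def)
  define s where "s n i = a + real_of_int i * \<delta> / sqrt (real n)" for n i
  have s_lim: "(\<lambda>n. s n i) \<longlonglongrightarrow> a" for i
    unfolding s_def
    by (rule tendsto_eq_rhs[OF tendsto_add[OF tendsto_const tendsto_divide_0[OF tendsto_const
        filterlim_at_top_imp_at_infinity[OF filterlim_compose[OF sqrt_at_top filterlim_real_sequentially]]]]]) simp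
  have s01: "eventually (\<lambda>n. \<forall>i\<in>I. s n i \<in> {0<..<1}) sequentially"
  proof (rule eventually_ball_finite[OF fin], rule ballI)
    fix i
    show "eventually (\<lambda>n. s n i \<in> {0<..<1}) sequentially"
      using a by (intro topological_tendstoD[OF s_lim]) auto
  qed
  have abs_lim: "(\<lambda>n. \<bar>s n i - a\<bar>) \<longlonglongrightarrow> 0" for i
    using tendsto_rabs[OF tendsto_diff[OF s_lim tendsto_const, of i a]] by simp
  have abs_lim2: "(\<lambda>n. \<bar>s n (fst p) - a\<bar> + \<bar>s n (snd p) - a\<bar>) \<longlonglongrightarrow> 0" for p
    using tendsto_add[OF abs_lim[of "fst p"] abs_lim[of "snd p"]] by simp
  define AX where "AX i n = {\<omega> \<in> space M. \<bar>csum n (below_X (s n i)) \<omega> - csum n (below_X a) \<omega>\<bar> > \<delta> * sqrt n}" for i n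
  define AY where "AY i n = {\<omega> \<in> space M. \<bar>csum n (below_Y (s n i)) \<omega> - csum n (below_Y a) \<omega>\<bar> > \<delta> * sqrt n}" for i n
  define AXY where "AXY p n = {\<omega> \<in> space M. \<bar>csum n (below_XY (s n (fst p)) (s n (snd p))) \<omega>
      - csum n (below_XY a a) \<omega>\<bar> > \<delta> * sqrt n}" for p n
  define TX where "TX n = {\<omega> \<in> space M. \<bar>csum n (below_X a) \<omega>\<bar> \<ge> K * sqrt n}" for n
  define TY where "TY n = {\<omega> \<in> space M. \<bar>csum n (below_Y a) \<omega>\<bar> \<ge> K * sqrt n}" for n
  note [measurable] = csum_measurable[OF bdd_below_X] csum_measurable[OF bdd_below_Y]
    csum_measurable[OF bdd_below_XY]
  have [measurable]: "AX i n \<in> events" "AY i n \<in> events" "AXY p n \<in> events" "TX n \<in> events" "TY n \<in> events"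
    for i p n
    unfolding AX_def AY_def AXY_def TX_def TY_def by measurable
  have "eventually (\<lambda>n. prob (\<Union>i\<in>I. AX i n) \<le> \<eta> / 8) sequentially"
  proof (rule eventually_prob_Union_le[OF fin])
    fix i and \<eta>' :: real assume i: "i \<in> I" "\<eta>' > 0"
    show "eventually (\<lambda>n. prob (AX i n) \<le> \<eta>') sequentially"
      unfolding AX_def
    proof (rule eventually_prob_csum_le[OF bdd_below_X bdd_below_X \<delta>(1) i(2) abs_lim[of i]])
      show "eventually (\<lambda>n. mean (\<lambda>z. (below_X (s n i) z - below_X a z)\<^sup>2) \<le> \<bar>s n i - a\<bar>) sequentially"
        using s01 by eventually_elim (use i a mean_square_diff(1) in auto)
    qed
  qed (use \<open>\<eta> > 0\<close> in auto)
  moreover have "eventually (\<lambda>n. prob (\<Union>i\<in>I. AY i n) \<le> \<eta> / 8) sequentially"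
  proof (rule eventually_prob_Union_le[OF fin])
    fix i and \<eta>' :: real assume i: "i \<in> I" "\<eta>' > 0"
    show "eventually (\<lambda>n. prob (AY i n) \<le> \<eta>') sequentially"
      unfolding AY_def
    proof (rule eventually_prob_csum_le[OF bdd_below_Y bdd_below_Y \<delta>(1) i(2) abs_lim[of i]])
      show "eventually (\<lambda>n. mean (\<lambda>z. (below_Y (s n i) z - below_Y a z)\<^sup>2) \<le> \<bar>s n i - a\<bar>) sequentially"
        using s01 by eventually_elim (use i a mean_square_diff(2) in auto)
    qed
  qed (use \<open>\<eta> > 0\<close> in auto)
  moreover have "eventually (\<lambda>n. prob (\<Union>p\<in>I\<times>I. AXY p n) \<le> \<eta> / 8) sequentially"
  proof (rule eventually_prob_Union_le)
    fix p and \<eta>' :: real assume p: "p \<in> I \<times> I" "\<eta>' > 0"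
    show "eventually (\<lambda>n. prob (AXY p n) \<le> \<eta>') sequentially"
      unfolding AXY_def
    proof (rule eventually_prob_csum_le[OF bdd_below_XY bdd_below_XY \<delta>(1) p(2) abs_lim2[of p]])
      show "eventually (\<lambda>n. mean (\<lambda>z. (below_XY (s n (fst p)) (s n (snd p)) z - below_XY a a z)\<^sup>2)
          \<le> \<bar>s n (fst p) - a\<bar> + \<bar>s n (snd p) - a\<bar>) sequentially"
        using s01 by eventually_elim (use p a in \<open>auto intro!: mean_square_diff_XY\<close>)
    qed
  qed (use \<open>\<eta> > 0\<close> fin in auto)
  moreover have "eventually (\<lambda>n. \<forall>i\<in>I. \<forall>j\<in>I.
      \<bar>sqrt n * (C (s n i) (s n j) - C a a) - (h1 C a a * (i * \<delta>) + h2 C a a * (j * \<delta>))\<bar> \<le> \<delta>) sequentially"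
  proof (intro eventually_ball_finite[OF fin] ballI)
    fix i j
    have "(\<lambda>n. sqrt n * (C (s n i) (s n j) - C a a)) \<longlonglongrightarrow> h1 C a a * (i * \<delta>) + h2 C a a * (j * \<delta>)"
      unfolding s_def by (rule continuous_partials_tendsto[OF partials a a])
    from tendstoD[OF this \<delta>(1)]
    show "eventually (\<lambda>n. \<bar>sqrt n * (C (s n i) (s n j) - C a a)
        - (h1 C a a * (i * \<delta>) + h2 C a a * (j * \<delta>))\<bar> \<le> \<delta>) sequentially"
      by eventually_elim (simp add: dist_real_def)
  qed
  ultimately show ?thesis
    using s01 eventually_ge_at_top[of 1]
  proof eventually_elim
    case (elim n)
    have "prob (TX n) \<le> cov (below_X a) (below_X a) / K\<^sup>2"
      unfolding TX_def using elim \<open>K > 0\<close> by (intro prob_csum_le bdd_below) auto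
    also have "\<dots> \<le> 1 / K\<^sup>2"
      using a by (intro divide_right_mono) (auto simp: cov_def mean_mult mean_below intro: order.trans[of _ a])
    finally have TX: "prob (TX n) \<le> \<eta> / 8"
      using tail by linarith
    have "prob (TY n) \<le> cov (below_Y a) (below_Y a) / K\<^sup>2"
      unfolding TY_def using elim \<open>K > 0\<close> by (intro prob_csum_le bdd_below) auto
    also have "\<dots> \<le> 1 / K\<^sup>2"
      using a by (intro divide_right_mono) (auto simp: cov_def mean_mult mean_below intro: order.trans[of _ a])
    finally have TY: "prob (TY n) \<le> \<eta> / 8"
      using tail by linarith
    let ?A = "\<Union>i\<in>I. AX i n" and ?B = "\<Union>i\<in>I. AY i n" and ?C = "\<Union>p\<in>I\<times>I. AXY p n"
    have [measurable]: "?A \<in> events" "?B \<in> events" "?C \<in> events"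
      using fin by auto
    have "{\<omega> \<in> space M. \<bar>remainder a n \<omega>\<bar> > \<epsilon>} \<subseteq> (((?A \<union> ?B) \<union> ?C) \<union> TX n) \<union> TY n"
    proof (rule subsetI, rule ccontr)
      fix \<omega> assume \<omega>: "\<omega> \<in> {\<omega> \<in> space M. \<bar>remainder a n \<omega>\<bar> > \<epsilon>}"
        and good: "\<omega> \<notin> (((?A \<union> ?B) \<union> ?C) \<union> TX n) \<union> TY n"
      have "\<bar>remainder a n \<omega>\<bar> \<le> (2 + 2 * \<bar>h1 C a a\<bar> + 2 * \<bar>h2 C a a\<bar>) * \<delta>"
      proof (rule remainder_le_grid[where s="s n" and L=L])
        show "s n i = a + real_of_int i * \<delta> / sqrt n" for i
          by (simp add: s_def)
        show "\<bar>csum n (below_XY (s n i) (s n j)) \<omega> - csum n (below_XY a a) \<omega>\<bar> \<le> \<delta> * sqrt n"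
          if "i \<in> {- int L..int L}" "j \<in> {- int L..int L}" for i j
        proof -
          have "(i, j) \<in> I \<times> I" "\<omega> \<in> space M" "\<omega> \<notin> ?C"
            using that \<omega> good by (auto simp: I_def)
          then have "\<omega> \<notin> AXY (i, j) n"
            by blast
          then show ?thesis
            using \<open>\<omega> \<in> space M\<close> by (simp add: AXY_def not_less)
        qed
      qed (use elim \<omega> good a \<delta> in \<open>auto simp: I_def AX_def AY_def TX_def TY_def K_def not_less not_le\<close>)
      then show False
        using \<omega> \<delta>(2) by (simp add: c_def)
    qed
    then have "prob {\<omega> \<in> space M. \<bar>remainder a n \<omega>\<bar> > \<epsilon>} \<le> prob ((((?A \<union> ?B) \<union> ?C) \<union> TX n) \<union> TY n)"
      by (intro finite_measure_mono) auto
    also have "\<dots> \<le> (((prob ?A + prob ?B) + prob ?C) + prob (TX n)) + prob (TY n)"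
      by (intro order.trans[OF measure_Un_le] add_mono order.refl) auto
    \<comment> \<open>Five events of probability at most \<open>\<eta> / 8\<close> each.\<close>
    also have "\<dots> \<le> \<eta>"
      using elim TX TY \<open>\<eta> > 0\<close> by linarith
    finally show ?case .
  qed
qed

lemma remainder_L2:
  assumes "a \<in> {0<..<1}"
  shows "(\<lambda>n. expectation (\<lambda>\<omega>. (remainder a n \<omega>)\<^sup>2)) \<longlonglongrightarrow> 0"
proof -
  obtain K where "\<And>n. n \<ge> 1 \<Longrightarrow> expectation (\<lambda>\<omega>. remainder a n \<omega> ^ 4) \<le> K"
    using remainder_power4_bound[OF assms] by metis
  then show ?thesis
    using remainder_in_probability[OF assms]
    by (intro square_expectation_tendsto_0 remainder_measurable remainder_power_integrable)
qed

end

section \<open>Linear combinations of diagonal values of the empirical copula\<close>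

text \<open>General weights keep the averaging and the division by thresholds out of the limit
  argument; the estimator is the case \<open>c k = 1 / (m * \<alpha> k)\<close>.\<close>

locale copula_combination = copula_sample +
  fixes A :: "nat set" and c \<alpha> :: "nat \<Rightarrow> real"
  assumes \<alpha>: "\<And>k. k \<in> A \<Longrightarrow> \<alpha> k \<in> {0<..<1}"
begin

definition comb :: "nat \<Rightarrow> 'a \<Rightarrow> real" where
  "comb n \<omega> = (\<Sum>k\<in>A. c k * emp_diag (\<alpha> k) n \<omega>)"

definition comb_influence :: "real \<times> real \<Rightarrow> real" where
  "comb_influence z = (\<Sum>k\<in>A. c k * influence (\<alpha> k) z)"

definition comb_remainder :: "nat \<Rightarrow> 'a \<Rightarrow> real" where
  "comb_remainder n \<omega> = (\<Sum>k\<in>A. c k * remainder (\<alpha> k) n \<omega>)"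

lemma bdd_comb_influence: "bdd_borel comb_influence"
  unfolding comb_influence_def[abs_def] by (intro bdd_borel_intros bdd_influence)

lemma cov_comb_influence:
  "cov comb_influence comb_influence = (\<Sum>k\<in>A. \<Sum>l\<in>A. c k * c l * K_kernel C (\<alpha> k) (\<alpha> l))"
proof -
  have "cov comb_influence comb_influence
      = (\<Sum>k\<in>A. \<Sum>l\<in>A. c k * (c l * cov (influence (\<alpha> k)) (influence (\<alpha> l))))"
    unfolding comb_influence_def[abs_def]
    by (simp add: cov_sum_left cov_sum_right cov_cmult_left cov_cmult_right
        bdd_borel_intros bdd_influence sum_distrib_left)
  then show ?thesis
    by (simp only:) (intro sum.cong refl, simp add: cov_influence[OF \<alpha> \<alpha>] mult.assoc)
qed

lemma comb_decomposition:
  assumes "n \<ge> 1"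
  shows "sqrt n * (comb n \<omega> - (\<Sum>k\<in>A. c k * C (\<alpha> k) (\<alpha> k)))
    = csum n comb_influence \<omega> / sqrt n + comb_remainder n \<omega>"
proof -
  have "csum n comb_influence \<omega> = (\<Sum>k\<in>A. c k * csum n (influence (\<alpha> k)) \<omega>)"
    unfolding comb_influence_def[abs_def]
    by (simp add: csum_sum csum_cmult bdd_borel_intros bdd_influence)
  then show ?thesis
    by (simp add: comb_def comb_remainder_def remainder_def sum_distrib_left sum_divide_distrib
        sum.distrib[symmetric] sum_subtractf[symmetric] algebra_simps)
qed

lemma comb_measurable: "comb n \<in> borel_measurable M"
  unfolding comb_def using emp_diag_measurable by measurable

lemma comb_power_integrable: "integrable M (\<lambda>\<omega>. comb n \<omega> ^ p)"
proof -
  have "\<bar>comb n \<omega>\<bar> \<le> (\<Sum>k\<in>A. \<bar>c k\<bar> * 1)" for \<omega>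
    unfolding comb_def
    by (intro order.trans[OF sum_abs] sum_mono) (auto simp: abs_mult emp_diag_bounded intro!: mult_left_le)
  then have "\<bar>comb n \<omega> ^ p\<bar> \<le> (\<Sum>k\<in>A. \<bar>c k\<bar> * 1) ^ p" for \<omega>
    unfolding power_abs by (intro power_mono) auto
  then show ?thesis
    using comb_measurable[of n] by (intro integrable_bdd[where B="(\<Sum>k\<in>A. \<bar>c k\<bar> * 1) ^ p"]) auto
qed

lemma comb_remainder_bounded: obtains B where "B \<ge> 0" "\<And>\<omega>. \<bar>comb_remainder n \<omega>\<bar> \<le> B"
proof -
  have "\<forall>k. \<exists>B\<ge>0. \<forall>\<omega>. \<bar>remainder (\<alpha> k) n \<omega>\<bar> \<le> B"
    using remainder_bounded by metis
  then obtain B where B: "\<And>k. B k \<ge> 0" "\<And>k \<omega>. \<bar>remainder (\<alpha> k) n \<omega>\<bar> \<le> B k"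
    by metis
  have "\<bar>comb_remainder n \<omega>\<bar> \<le> (\<Sum>k\<in>A. \<bar>c k\<bar> * B k)" for \<omega>
    unfolding comb_remainder_def
    by (intro order.trans[OF sum_abs] sum_mono) (auto simp: abs_mult B intro!: mult_left_mono)
  then show ?thesis
    using B(1) by (intro that[of "\<Sum>k\<in>A. \<bar>c k\<bar> * B k"]) (auto intro!: sum_nonneg)
qed

lemma comb_remainder_measurable: "comb_remainder n \<in> borel_measurable M"
  unfolding comb_remainder_def using remainder_measurable by measurable

text \<open>The square of a sum is at most the number of terms times the sum of the squares, so the
  convergence passes from the single remainders to their combination.\<close>

lemma comb_remainder_L2: "(\<lambda>n. expectation (\<lambda>\<omega>. (comb_remainder n \<omega>)\<^sup>2)) \<longlonglongrightarrow> 0"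
proof (rule tendsto_sandwich[where f="\<lambda>_. 0"])
  show "eventually (\<lambda>n. expectation (\<lambda>\<omega>. (comb_remainder n \<omega>)\<^sup>2)
      \<le> (\<Sum>k\<in>A. (c k)\<^sup>2 * expectation (\<lambda>\<omega>. (remainder (\<alpha> k) n \<omega>)\<^sup>2)) * card A) sequentially"
  proof (intro always_eventually allI)
    fix n
    have int: "integrable M (\<lambda>\<omega>. (\<Sum>k\<in>A. (c k)\<^sup>2 * (remainder (\<alpha> k) n \<omega>)\<^sup>2) * card A)"
      by (intro integrable_mult_left Bochner_Integration.integrable_sum integrable_mult_right
          remainder_power_integrable)
    have le: "(comb_remainder n \<omega>)\<^sup>2 \<le> (\<Sum>k\<in>A. (c k)\<^sup>2 * (remainder (\<alpha> k) n \<omega>)\<^sup>2) * card A" for \<omega>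
      using sum_squared_le_sum_of_squares[of "\<lambda>k. c k * remainder (\<alpha> k) n \<omega>" A]
      by (simp add: comb_remainder_def power_mult_distrib)
    have "expectation (\<lambda>\<omega>. (comb_remainder n \<omega>)\<^sup>2)
        \<le> expectation (\<lambda>\<omega>. (\<Sum>k\<in>A. (c k)\<^sup>2 * (remainder (\<alpha> k) n \<omega>)\<^sup>2) * card A)"
      using le order.trans[OF zero_le_power2 le] by (intro integral_mono' int)
    also have "\<dots> = (\<Sum>k\<in>A. (c k)\<^sup>2 * expectation (\<lambda>\<omega>. (remainder (\<alpha> k) n \<omega>)\<^sup>2)) * card A"
      using remainder_power_integrable[where p=2] by (simp add: Bochner_Integration.integral_sum)
    finally show "expectation (\<lambda>\<omega>. (comb_remainder n \<omega>)\<^sup>2)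
        \<le> (\<Sum>k\<in>A. (c k)\<^sup>2 * expectation (\<lambda>\<omega>. (remainder (\<alpha> k) n \<omega>)\<^sup>2)) * card A" .
  qed
  have "(\<lambda>n. (\<Sum>k\<in>A. (c k)\<^sup>2 * expectation (\<lambda>\<omega>. (remainder (\<alpha> k) n \<omega>)\<^sup>2)) * card A)
      \<longlonglongrightarrow> (\<Sum>k\<in>A. (c k)\<^sup>2 * 0) * card A"
    by (intro tendsto_intros remainder_L2 \<alpha>)
  then show "(\<lambda>n. (\<Sum>k\<in>A. (c k)\<^sup>2 * expectation (\<lambda>\<omega>. (remainder (\<alpha> k) n \<omega>)\<^sup>2)) * card A) \<longlonglongrightarrow> 0"
    by simp
qed (auto intro!: always_eventually)

lemma comb_remainder_integrable:
  "integrable M (comb_remainder n)" "integrable M (\<lambda>\<omega>. (comb_remainder n \<omega>)\<^sup>2)"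
proof -
  obtain B where B: "B \<ge> 0" "\<And>\<omega>. \<bar>comb_remainder n \<omega>\<bar> \<le> B"
    using comb_remainder_bounded by metis
  have "(comb_remainder n \<omega>)\<^sup>2 \<le> B\<^sup>2" for \<omega>
    using B by (simp add: abs_le_square_iff[symmetric])
  then show "integrable M (\<lambda>\<omega>. (comb_remainder n \<omega>)\<^sup>2)"
    using comb_remainder_measurable[of n] by (intro integrable_bdd[where B="B\<^sup>2"]) auto
  show "integrable M (comb_remainder n)"
    using comb_remainder_measurable B(2) by (rule integrable_bdd)
qed

lemma comb_remainder_mean: "(\<lambda>n. expectation (comb_remainder n)) \<longlonglongrightarrow> 0"
proof (rule tendsto_0_le[where K=1])
  show "(\<lambda>n. sqrt (expectation (\<lambda>\<omega>. (comb_remainder n \<omega>)\<^sup>2))) \<longlonglongrightarrow> 0"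
    using tendsto_real_sqrt[OF comb_remainder_L2] by simp
  show "eventually (\<lambda>n. norm (expectation (comb_remainder n))
      \<le> norm (sqrt (expectation (\<lambda>\<omega>. (comb_remainder n \<omega>)\<^sup>2))) * 1) sequentially"
    using square_expectation_le[OF comb_remainder_integrable]
    by (intro always_eventually allI) (simp add: real_le_rsqrt)
qed

text \<open>The linear part has mean zero, so the rescaled bias is exactly the mean of the
  remainder.\<close>

lemma comb_bias:
  "(\<lambda>n. sqrt n * (expectation (comb n) - (\<Sum>k\<in>A. c k * C (\<alpha> k) (\<alpha> k)))) \<longlonglongrightarrow> 0"
proof (rule Lim_transform_eventually[OF comb_remainder_mean])
  show "eventually (\<lambda>n. expectation (comb_remainder n)
      = sqrt n * (expectation (comb n) - (\<Sum>k\<in>A. c k * C (\<alpha> k) (\<alpha> k)))) sequentially"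
    using eventually_ge_at_top[of 1]
  proof eventually_elim
    case (elim n)
    have "expectation (\<lambda>\<omega>. sqrt n * (comb n \<omega> - (\<Sum>k\<in>A. c k * C (\<alpha> k) (\<alpha> k))))
        = expectation (\<lambda>\<omega>. csum n comb_influence \<omega> / sqrt n + comb_remainder n \<omega>)"
      using comb_decomposition[OF elim] by simp
    also have "\<dots> = expectation (comb_remainder n)"
      using comb_remainder_integrable(1) csum_power_integrable[OF bdd_comb_influence, of n 1]
      by (simp add: expectation_csum[OF bdd_comb_influence])
    finally show ?case
      using comb_power_integrable[of n 1] by (simp add: prob_space)
  qed
qed

text \<open>With the rescaled error split as \<open>U + R\<close>, the square of \<open>U\<close>
  has mean \<open>v\<close> for every \<open>n \<ge> 1\<close>, that of \<open>R\<close> has mean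
  tending to \<open>0\<close>, and Cauchy-Schwarz handles the mixed term.\<close>

lemma comb_variance:
  "(\<lambda>n. real n * variance (comb n)) \<longlonglongrightarrow> (\<Sum>k\<in>A. \<Sum>l\<in>A. c k * c l * K_kernel C (\<alpha> k) (\<alpha> l))"
proof -
  define v where "v = cov comb_influence comb_influence"
  define U where "U n \<omega> = csum n comb_influence \<omega> / sqrt (real n)" for n \<omega>
  define R where "R = comb_remainder"
  define \<theta> where "\<theta> = (\<Sum>k\<in>A. c k * C (\<alpha> k) (\<alpha> k))"
  have [measurable]: "U n \<in> borel_measurable M" "R n \<in> borel_measurable M" for n
    unfolding U_def R_def using csum_measurable[OF bdd_comb_influence, of n] comb_remainder_measurable
    by auto
  have int_U: "integrable M (U n)" "integrable M (\<lambda>\<omega>. (U n \<omega>)\<^sup>2)" for n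
    unfolding U_def using csum_power_integrable[OF bdd_comb_influence, of n 1]
      csum_power_integrable[OF bdd_comb_influence, of n 2]
    by (simp_all add: power_divide)
  have int_R: "integrable M (R n)" "integrable M (\<lambda>\<omega>. (R n \<omega>)\<^sup>2)" for n
    unfolding R_def by (fact comb_remainder_integrable)+
  have EU: "expectation (U n) = 0" for n
    unfolding U_def by (simp add: expectation_csum[OF bdd_comb_influence])
  have EU2: "expectation (\<lambda>\<omega>. (U n \<omega>)\<^sup>2) = v" if "n \<ge> 1" for n
    using expectation_csum_csum[OF bdd_comb_influence bdd_comb_influence, of n] that
    by (simp add: U_def v_def power2_eq_square)
  have int_UR: "integrable M (\<lambda>\<omega>. U n \<omega> * R n \<omega>)" for n
  proof (rule Bochner_Integration.integrable_bound)
    show "integrable M (\<lambda>\<omega>. (U n \<omega>)\<^sup>2 + (R n \<omega>)\<^sup>2)"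
      by (intro Bochner_Integration.integrable_add int_U int_R)
    have "\<bar>x * y\<bar> \<le> x\<^sup>2 + y\<^sup>2" for x y :: real
      using sum_squares_bound[of "\<bar>x\<bar>" "\<bar>y\<bar>"] mult_nonneg_nonneg[of "\<bar>x\<bar>" "\<bar>y\<bar>"]
      unfolding abs_mult power2_abs by linarith
    then show "AE \<omega> in M. norm (U n \<omega> * R n \<omega>) \<le> norm ((U n \<omega>)\<^sup>2 + (R n \<omega>)\<^sup>2)"
      by simp
  qed measurable
  have CS: "\<bar>expectation (\<lambda>\<omega>. U n \<omega> * R n \<omega>)\<bar>
      \<le> sqrt (expectation (\<lambda>\<omega>. (U n \<omega>)\<^sup>2)) * sqrt (expectation (\<lambda>\<omega>. (R n \<omega>)\<^sup>2))" for n
    using Cauchy_Schwarz_expectation[OF int_U(2) int_R(2) int_UR]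
    by (simp add: real_le_rsqrt flip: real_sqrt_mult)
  have UR: "(\<lambda>n. expectation (\<lambda>\<omega>. U n \<omega> * R n \<omega>)) \<longlonglongrightarrow> 0"
  proof (rule tendsto_0_le[where K="sqrt v"])
    show "(\<lambda>n. sqrt (expectation (\<lambda>\<omega>. (R n \<omega>)\<^sup>2))) \<longlonglongrightarrow> 0"
      unfolding R_def using tendsto_real_sqrt[OF comb_remainder_L2] by simp
    show "eventually (\<lambda>n. norm (expectation (\<lambda>\<omega>. U n \<omega> * R n \<omega>))
        \<le> norm (sqrt (expectation (\<lambda>\<omega>. (R n \<omega>)\<^sup>2))) * sqrt v) sequentially"
      using eventually_ge_at_top[of 1]
    proof eventually_elim
      case (elim n)
      then show ?case
        using CS[of n] EU2[of n] by (simp add: mult.commute[of _ "sqrt v"])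
    qed
  qed
  have "(\<lambda>n. v + 2 * expectation (\<lambda>\<omega>. U n \<omega> * R n \<omega>) + expectation (\<lambda>\<omega>. (R n \<omega>)\<^sup>2)
      - (expectation (R n))\<^sup>2) \<longlonglongrightarrow> v + 2 * 0 + 0 - 0\<^sup>2"
    unfolding R_def
    by (intro tendsto_intros UR[unfolded R_def] comb_remainder_L2 comb_remainder_mean)
  then have lim: "(\<lambda>n. v + 2 * expectation (\<lambda>\<omega>. U n \<omega> * R n \<omega>) + expectation (\<lambda>\<omega>. (R n \<omega>)\<^sup>2)
      - (expectation (R n))\<^sup>2) \<longlonglongrightarrow> v"
    by simp
  have "(\<lambda>n. real n * variance (comb n)) \<longlonglongrightarrow> v"
  proof (rule Lim_transform_eventually[OF lim], rule eventually_mono[OF eventually_ge_at_top[of 1]])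
    fix n :: nat assume n: "n \<ge> 1"
    have dec: "sqrt n * (comb n \<omega> - \<theta>) = U n \<omega> + R n \<omega>" for \<omega>
      using comb_decomposition[OF n] by (simp add: \<theta>_def U_def R_def)
    have int_c: "integrable M (comb n)"
      using comb_power_integrable[of n 1] by simp
    have "expectation (\<lambda>\<omega>. sqrt n * (comb n \<omega> - \<theta>)) = expectation (R n)"
      unfolding dec using int_U int_R EU by simp
    then have mean: "sqrt n * (expectation (comb n) - \<theta>) = expectation (R n)"
      using int_c by (simp add: prob_space)
    \<comment> \<open>The constant \<open>\<theta>\<close> cancels, leaving \<open>U + R\<close>
      centred at its mean \<open>E R\<close>.\<close>
    have "real n * (comb n \<omega> - expectation (comb n))\<^sup>2
        = (U n \<omega> + R n \<omega> - expectation (R n))\<^sup>2" for \<omega>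
      unfolding dec[symmetric] mean[symmetric]
      by (simp add: power_mult_distrib flip: right_diff_distrib)
    also have "(U n \<omega> + R n \<omega> - expectation (R n))\<^sup>2 = (U n \<omega>)\<^sup>2 + 2 * (U n \<omega> * R n \<omega>) + (R n \<omega>)\<^sup>2
        - 2 * expectation (R n) * U n \<omega> - 2 * expectation (R n) * R n \<omega> + (expectation (R n))\<^sup>2" for \<omega>
      by (simp add: power2_eq_square algebra_simps)
    finally have "real n * variance (comb n) = expectation (\<lambda>\<omega>. (U n \<omega>)\<^sup>2 + 2 * (U n \<omega> * R n \<omega>) + (R n \<omega>)\<^sup>2
        - 2 * expectation (R n) * U n \<omega> - 2 * expectation (R n) * R n \<omega> + (expectation (R n))\<^sup>2)"
      by (simp flip: Bochner_Integration.integral_mult_right_zero)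
    also have "\<dots> = v + 2 * expectation (\<lambda>\<omega>. U n \<omega> * R n \<omega>) + expectation (\<lambda>\<omega>. (R n \<omega>)\<^sup>2)
        - (expectation (R n))\<^sup>2"
      using int_U int_R int_UR EU EU2[OF n] by (simp add: prob_space power2_eq_square)
    finally show "v + 2 * expectation (\<lambda>\<omega>. U n \<omega> * R n \<omega>) + expectation (\<lambda>\<omega>. (R n \<omega>)\<^sup>2)
        - (expectation (R n))\<^sup>2 = real n * variance (comb n)" by simp
  qed
  then show ?thesis
    by (simp add: v_def cov_comb_influence)
qed

lemma comb_mean_squared_error:
  "expectation (\<lambda>\<omega>. (comb n \<omega> - t)\<^sup>2) = variance (comb n) + (expectation (comb n) - t)\<^sup>2"
proof -
  have int: "integrable M (comb n)" "integrable M (\<lambda>\<omega>. (comb n \<omega>)\<^sup>2)"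
    using comb_power_integrable[of n 1] comb_power_integrable[of n 2] by auto
  have "expectation (\<lambda>\<omega>. (comb n \<omega> - t)\<^sup>2) = expectation (\<lambda>\<omega>. (comb n \<omega>)\<^sup>2 - 2 * t * comb n \<omega> + t\<^sup>2)"
    by (simp add: power2_eq_square algebra_simps)
  also have "\<dots> = expectation (\<lambda>\<omega>. (comb n \<omega>)\<^sup>2) - 2 * t * expectation (comb n) + t\<^sup>2"
    using int by (simp add: prob_space)
  finally show ?thesis
    unfolding variance_eq[OF int] by (simp add: power2_eq_square algebra_simps)
qed

end

text \<open>For finite \<open>n\<close> the squared term contains the exact bias, and
  \<open>r n\<close> is the gap between the expectation of the estimator and its limit. Its rate
  makes the gap negligible on the scale \<open>1 / sqrt n\<close>.\<close>

theorem theorem3: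
  fixes M :: "'a measure"
    and X Y :: "nat \<Rightarrow> 'a \<Rightarrow> real"
    and C :: "real \<Rightarrow> real \<Rightarrow> real"
    and m :: nat
    and \<alpha> :: "nat \<Rightarrow> real"
    and Est :: "nat \<Rightarrow> 'a \<Rightarrow> real"
    and V :: "nat \<Rightarrow> real"
  assumes prob: "prob_space M"
    and indep: "prob_space.indep_vars M (\<lambda>_. borel) (\<lambda>j \<omega>. (X j \<omega>, Y j \<omega>)) {1..}"
    and ident: "\<And>j. j \<ge> 1 \<Longrightarrow>
      distr M borel (\<lambda>\<omega>. (X j \<omega>, Y j \<omega>)) = distr M borel (\<lambda>\<omega>. (X 1 \<omega>, Y 1 \<omega>))"
    and cont_X: "continuous_on UNIV (cdf (distr M borel (X 1)))"
    and cont_Y: "continuous_on UNIV (cdf (distr M borel (Y 1)))"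
    and copula: "copula_of M (X 1) (Y 1) C"
    and partials: "continuous_partials C"
    and tail: "\<exists>l. ((\<lambda>u. C u u / u) \<longlongrightarrow> l) (at_right 0)"
    and m: "m \<ge> 1"
    and alpha: "\<And>k. k \<in> {1..m} \<Longrightarrow> \<alpha> k \<in> {0<..<1}"
    and Est: "\<And>n \<omega>. Est n \<omega> =
      avg_tail_estimator (\<lambda>j. X j \<omega>) (\<lambda>j. Y j \<omega>) m n (\<lambda>k. \<alpha> k * real n)"
    and V: "\<And>n. V n = estimator_variance M (Est n)"
  shows "(\<exists>r :: nat \<Rightarrow> real.
           (\<forall>n\<ge>1. mean_squared_error M (Est n) (lower_tail_dependence C)
              = V n + ((\<Sum>k=1..m. 1 / \<alpha> k * diagonal C (\<alpha> k)) / real m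
                        - diagonal_deriv0 C + r n)\<^sup>2)
           \<and> (\<lambda>n. sqrt (real n) * r n) \<longlonglongrightarrow> 0)
    \<and> (\<lambda>n. real n * V n) \<longlonglongrightarrow>
        (\<Sum>k=1..m. \<Sum>l=1..m. 1 / (\<alpha> k * \<alpha> l) * K_kernel C (\<alpha> k) (\<alpha> l)) / (real m)\<^sup>2"
proof -
  interpret prob_space M by fact
  define c where "c = (\<lambda>k. 1 / (real m * \<alpha> k))"
  interpret copula_combination M X Y C "{1..m}" c \<alpha>
    by unfold_locales
      (fact indep ident cont_X cont_Y copula partials alpha)+
  let ?\<theta> = "(\<Sum>k=1..m. 1 / \<alpha> k * diagonal C (\<alpha> k)) / real m"
  \<comment> \<open>The condition \<open>n \<ge> 1\<close> lets \<open>\<alpha> k * n / n\<close>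
    cancel to \<open>\<alpha> k\<close>.\<close>
  have Est_eq: "Est n = comb n" if "n \<ge> 1" for n
    unfolding fun_eq_iff Est avg_tail_estimator_def tail_estimator_def comb_def emp_diag_def
    using that by (simp add: c_def sum_divide_distrib mult.commute)
  have V_eq: "V n = variance (comb n)" if "n \<ge> 1" for n
    by (simp add: V estimator_variance_def Est_eq[OF that])
  have \<theta>: "(\<Sum>k=1..m. c k * C (\<alpha> k) (\<alpha> k)) = ?\<theta>"
    by (simp add: c_def diagonal_def sum_divide_distrib mult.commute)
  have lam: "lower_tail_dependence C = diagonal_deriv0 C"
    using tail copula lower_tail_dependence_eq_deriv by (auto simp: copula_of_def)
  define r where "r n = expectation (comb n) - ?\<theta>" for n
  have "mean_squared_error M (Est n) (lower_tail_dependence C)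
      = V n + (?\<theta> - diagonal_deriv0 C + r n)\<^sup>2" if "n \<ge> 1" for n
    using comb_mean_squared_error[of n "diagonal_deriv0 C"]
    by (simp add: mean_squared_error_def Est_eq[OF that] V_eq[OF that] lam r_def)
  moreover have "(\<lambda>n. sqrt (real n) * r n) \<longlonglongrightarrow> 0"
    using comb_bias unfolding r_def \<theta> .
  moreover have "(\<lambda>n. real n * V n) \<longlonglongrightarrow>
      (\<Sum>k=1..m. \<Sum>l=1..m. 1 / (\<alpha> k * \<alpha> l) * K_kernel C (\<alpha> k) (\<alpha> l)) / (real m)\<^sup>2"
  proof (rule Lim_transform_eventually)
    show "(\<lambda>n. real n * variance (comb n)) \<longlonglongrightarrow>
        (\<Sum>k=1..m. \<Sum>l=1..m. 1 / (\<alpha> k * \<alpha> l) * K_kernel C (\<alpha> k) (\<alpha> l)) / (real m)\<^sup>2"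
      using comb_variance
      by (simp add: c_def sum_divide_distrib power2_eq_square mult_ac)
    show "eventually (\<lambda>n. real n * variance (comb n) = real n * V n) sequentially"
      using eventually_ge_at_top[of 1] by eventually_elim (simp add: V_eq)
  qed
  ultimately show ?thesis
    by blast
qed

end
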